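(* Let $\Omega\subset\mathbb{R}^3$ be a domain disjoint from the RF antenna and containing the support of the contrast source function $\chi$. Let $\mathbf{E}$ be the incident electric field and let $B$ be the magnetic field induced by the object (both regarded as differential 1-forms as described in the context). If the fields $\mathbf{E}$ and $B$ are known, then the contrast source function can be found in $\Omega$ by $$\chi=-\frac{\left(\mathbf{E}-\ast \mathrm{d}B\right)\wedge\left(\Delta+k^{2}\right)B^{\ast}}{\left(\mathbf{E}-\ast \mathrm{d}B\right)\wedge\left(\mathrm{d}\mathbf{E}+k^{2}B^{\ast}\right)}$$ (a quotient of two 3-forms), if the denominator does not vanish.
   Context: Physical setting. Fix the angular (Larmor) frequency $\omega>0$, the vacuum permittivity $\varepsilon_0$, the constant permeability $\mu=\mu_0$ (spatial variations of permeability are ignored), the speed of light $c=c_0$ with $\varepsilon_0\mu_0=c^{-2}$, and $k=\omega/c_0$. Conductivity $\sigma$ and permittivity $\varepsilon$ of the object are isotropic (scalar functions). Put $\gamma=\sigma+i\varepsilon\omega$ (admittivity), $\gamma_0=i\omega\varepsilon_0$, and define the contrast source function $\chi(q)=\gamma(q)/\gamma_0-1$, whose support is contained in $\Omega$. The domain $\Omega$ is the object domain, disjoint from the antenna (coil) generating the RF wave. The total time-harmonic electromagnetic field in $\mathbb{R}^3$ is $\{E\exp(i\omega t),H\exp(i\omega t)\}$ with $E=\mathbf{E}+E^{sc}$, $H=\mathbf{H}+H^{sc}$, where $\{\mathbf{E},\mathbf{H}\}$ is the incident field and $\{E^{sc},H^{sc}\}$ is the scattered field due to the object. The scattered fields are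 represented by $$E^{sc}=(k^2+\nabla\nabla\cdot)A,\qquad H^{sc}=\gamma_0\nabla\times A,$$ where $A$ is the vector potential $$A(p)=\int_\Omega G(p-q)\chi(q)E(q)\,\mathrm{d}V(q),\quad p\in\mathbb{R}^3,\qquad G(q)=-\frac{\exp(ik|q|)}{4\pi|q|},$$ and $G$ is the scalar Green's function of the Helmholtz operator $\Delta+k^2$ in $\mathbb{R}^3$. The magnetic field $B$ is $B=\mu_0H^{sc}$. Differential forms. Electric and magnetic fields are written as 1-forms: $E=E_x\mathrm{d}x+E_y\mathrm{d}y+E_z\mathrm{d}z$, $B=B_x\mathrm{d}x+B_y\mathrm{d}y+B_z\mathrm{d}z$, and similarly $\mathbf{E}$. The Hodge star $\ast$ on $\mathbb{R}^3$ (also written $\alpha^\ast=\ast\alpha$) is linear and satisfies $\alpha^\ast\wedge\beta=\alpha\wedge\beta^\ast=\langle\alpha,\beta\rangle\,\mathrm{d}x\wedge\mathrm{d}y\wedge\mathrm{d}z$ for forms $\alpha,\beta$ of equal degree, with $\langle\cdot,\cdot\rangle$ the natural scalar product of forms; e.g. $(a\,\mathrm{d}x)^\ast=a\,\mathrm{d}y\wedge\mathrm{d}z$, $(a\,\mathrm{d}y\wedge\mathrm{d}z)^\ast=a\,\mathrm{d}x$ and cyclically. The dual differential is $\mathrm{d}^\ast=\ast\mathrm{d}\ast$, and the Laplace operator on forms is $\Delta=\mathrm{d}^\ast\mathrm{d}+\mathrm{d}\mathrm{d}^\ast$.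
   Formalization: The printed formula fails for the given definitions; with s=μ0γ0 it is corrected: E−∗dB becomes E+(1/s)∗dB, Δ+k² becomes Δ−k², and dE becomes s·dE. Also assumed: χ is C² with bounded support, the incident field is C² off the antenna, and the total field is C² in Ω. *)

theory Defs
  imports "HOL-Analysis.Analysis" "HOL-Library.Function_Algebras"
begin

definition partial :: "3 \<Rightarrow> (real^3 \<Rightarrow> 'a::real_normed_vector) \<Rightarrow> real^3 \<Rightarrow> 'a" where
  "partial i f p = vector_derivative (\<lambda>t. f (p + t *\<^sub>R axis i 1)) (at 0)"

text \<open>The class of \<open>n\<close> times continuously differentiable functions; meant for open \<open>S\<close>.\<close>

fun Ck_on :: "nat \<Rightarrow> (real^3) set \<Rightarrow> (real^3 \<Rightarrow> 'a::real_normed_vector) \<Rightarrow> bool" where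
  "Ck_on 0 S f \<longleftrightarrow> continuous_on S f"
| "Ck_on (Suc n) S f \<longleftrightarrow> f differentiable_on S \<and> (\<forall>i. Ck_on n S (partial i f))"

definition grad :: "(real^3 \<Rightarrow> complex) \<Rightarrow> real^3 \<Rightarrow> complex^3" where
  "grad f p = (\<chi> i. partial i f p)"

definition divergence :: "(real^3 \<Rightarrow> complex^3) \<Rightarrow> real^3 \<Rightarrow> complex" where
  "divergence F p = (\<Sum>i\<in>UNIV. partial i (\<lambda>q. F q $ i) p)"

definition curl :: "(real^3 \<Rightarrow> complex^3) \<Rightarrow> real^3 \<Rightarrow> complex^3" where
  "curl F p = vector
     [partial 2 (\<lambda>q. F q $ 3) p - partial 3 (\<lambda>q. F q $ 2) p,
      partial 3 (\<lambda>q. F q $ 1) p - partial 1 (\<lambda>q. F q $ 3) p,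
      partial 1 (\<lambda>q. F q $ 2) p - partial 2 (\<lambda>q. F q $ 1) p]"


definition vacuum_admittivity :: "real \<Rightarrow> real \<Rightarrow> complex" where
  "vacuum_admittivity \<omega> \<epsilon>0 = \<i> * of_real \<omega> * of_real \<epsilon>0"

definition admittivity :: "real \<Rightarrow> (real^3 \<Rightarrow> real) \<Rightarrow> (real^3 \<Rightarrow> real) \<Rightarrow> real^3 \<Rightarrow> complex" where
  "admittivity \<omega> \<sigma> \<epsilon> q = of_real (\<sigma> q) + \<i> * of_real (\<epsilon> q) * of_real \<omega>"

definition contrast ::
  "real \<Rightarrow> real \<Rightarrow> (real^3 \<Rightarrow> real) \<Rightarrow> (real^3 \<Rightarrow> real) \<Rightarrow> real^3 \<Rightarrow> complex" where
  "contrast \<omega> \<epsilon>0 \<sigma> \<epsilon> q = admittivity \<omega> \<sigma> \<epsilon> q / vacuum_admittivity \<omega> \<epsilon>0 - 1"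

text \<open>This is the fundamental solution of \<open>\<Delta> + k\<^sup>2\<close>: the distribution
  \<open>(\<Delta> + k\<^sup>2) G\<close> is \<open>+\<delta>\<close>.\<close>

definition green :: "real \<Rightarrow> real^3 \<Rightarrow> complex" where
  "green k q = - exp (\<i> * of_real (k * norm q)) / of_real (4 * pi * norm q)"

definition vector_potential ::
  "real \<Rightarrow> (real^3) set \<Rightarrow> (real^3 \<Rightarrow> complex) \<Rightarrow> (real^3 \<Rightarrow> complex^3) \<Rightarrow> real^3 \<Rightarrow> complex^3" where
  "vector_potential k \<Omega> X E p = (LINT q:\<Omega>|lborel. (green k (p - q) * X q) *s E q)"

definition scattered_electric :: "real \<Rightarrow> (real^3 \<Rightarrow> complex^3) \<Rightarrow> real^3 \<Rightarrow> complex^3" where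
  "scattered_electric k A p = of_real (k\<^sup>2) *s A p + grad (divergence A) p"

definition scattered_magnetic :: "complex \<Rightarrow> (real^3 \<Rightarrow> complex^3) \<Rightarrow> real^3 \<Rightarrow> complex^3" where
  "scattered_magnetic \<gamma>0 A p = \<gamma>0 *s curl A p"


text \<open>A form is given by its coefficients in the basis of the monomials \<open>dx\<^sub>I\<close>, where \<open>I\<close> ranges
  over all sets of coordinate indices and the factors of \<open>dx\<^sub>I\<close> are taken in the order
  \<open>dx, dy, dz\<close>; the coefficients of \<open>p\<close>-forms are those with \<open>card I = p\<close>, and the coefficient
  of \<open>dx \<and> dy \<and> dz\<close> is that of \<open>UNIV\<close>. The built-in order of the index type is of no
  use here, because there the numeral \<open>3\<close> is \<open>0\<close>.\<close>

type_synonym form = "real^3 \<Rightarrow> 3 set \<Rightarrow> complex"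

definition pos :: "3 \<Rightarrow> nat" where
  "pos i = (if i = 1 then 1 else if i = 2 then 2 else 3)"

text \<open>The sign in \<open>dx\<^sub>I \<and> dx\<^sub>J = wsign I J \<cdot> dx\<^bsub>I \<union> J\<^esub>\<close>: the parity of the number of inversions.\<close>

definition wsign :: "3 set \<Rightarrow> 3 set \<Rightarrow> complex" where
  "wsign I J = (if I \<inter> J = {} then (-1) ^ card {(i, j) \<in> I \<times> J. pos j < pos i} else 0)"

definition wedge :: "form \<Rightarrow> form \<Rightarrow> form"  (infixr "\<^bold>\<and>" 70) where
  "(\<alpha> \<^bold>\<and> \<beta>) p K = (\<Sum>I\<in>Pow K. wsign I (K - I) * \<alpha> p I * \<beta> p (K - I))"

definition ext_d :: "form \<Rightarrow> form" where
  "ext_d \<alpha> p K = (\<Sum>i\<in>K. wsign {i} (K - {i}) * partial i (\<lambda>q. \<alpha> q (K - {i})) p)"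

definition hodge :: "form \<Rightarrow> form" where
  "hodge \<alpha> p K = wsign K (- K) * \<alpha> p (- K)"

definition dual_d :: "form \<Rightarrow> form" where
  "dual_d \<alpha> = hodge (ext_d (hodge \<alpha>))"

text \<open>No signs are inserted in the dual differential. On coclosed 1-forms this operator is
  therefore the curl of the curl, that is, minus the componentwise Laplacian.\<close>

definition form_laplacian :: "form \<Rightarrow> form" where
  "form_laplacian \<alpha> = dual_d (ext_d \<alpha>) + ext_d (dual_d \<alpha>)"

definition form_scale :: "complex \<Rightarrow> form \<Rightarrow> form"  (infixr "\<^bold>\<cdot>" 75) where
  "(c \<^bold>\<cdot> \<alpha>) p K = c * \<alpha> p K"

definition one_form :: "(real^3 \<Rightarrow> complex^3) \<Rightarrow> form" where
  "one_form F p K = (\<Sum>i\<in>UNIV. if K = {i} then F p $ i else 0)"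

definition volume_coeff :: "form \<Rightarrow> real^3 \<Rightarrow> complex" where
  "volume_coeff \<alpha> p = \<alpha> p UNIV"


lemma wsign_code:
  "wsign I J = (if I \<inter> J = {} then
     (if 2 \<in> I \<and> 1 \<in> J then -1 else 1) * (if 3 \<in> I \<and> 1 \<in> J then -1 else 1) *
     (if 3 \<in> I \<and> 2 \<in> J then -1 else 1) else 0)"
proof -
  let ?S = "{(i, j) \<in> I \<times> J. pos j < pos i}"
  have *: "?S = (if 2 \<in> I \<and> 1 \<in> J then {(2,1)} else {}) \<union> (if 3 \<in> I \<and> 1 \<in> J then {(3,1)} else {})
      \<union> (if 3 \<in> I \<and> 2 \<in> J then {(3,2)} else {})" (is "_ = ?A \<union> ?B \<union> ?C")
  proof (intro set_eqI)
    fix x :: "3 \<times> 3"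
    obtain i j where x: "x = (i, j)" by (cases x)
    show "x \<in> ?S \<longleftrightarrow> x \<in> ?A \<union> ?B \<union> ?C"
      unfolding x using exhaust_3[of i] exhaust_3[of j]
      by (elim disjE) (simp_all add: pos_def)
  qed
  have "card ?S = card ?A + card ?B + card ?C"
    unfolding * by (subst card_Un_disjoint; (subst card_Un_disjoint)?) auto
  then show ?thesis
    unfolding wsign_def by (simp add: power_add)
qed

lemma set3_cases:
  "(K :: 3 set) \<in> {{}, {1}, {2}, {3}, {1,2}, {1,3}, {2,3}, UNIV}"
proof -
  have "K \<in> Pow {1,2,3}" using UNIV_3 by auto
  then show ?thesis unfolding Pow_insert Pow_empty UNIV_3 by auto
qed

lemma Compl_3:
  "- {1::3} = {2,3}" "- {2::3} = {1,3}" "- {3::3} = {1,2}"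
  "- {2::3,3} = {1}" "- {1::3,3} = {2}" "- {1::3,2} = {3}"
  using UNIV_3 by auto

lemma hodge_hodge: "hodge (hodge \<alpha>) = \<alpha>"
proof (intro ext)
  fix p K
  show "hodge (hodge \<alpha>) p K = \<alpha> p K"
    using set3_cases[of K] by (auto simp: hodge_def wsign_code)
qed

lemma UNIV_3_neq: "(UNIV :: 3 set) \<noteq> {a}" "(UNIV :: 3 set) \<noteq> {a, b}"
proof -
  have *: "(UNIV :: 3 set) \<noteq> {a, b}" for a b
  proof
    assume "(UNIV :: 3 set) = {a, b}"
    then have "card (UNIV :: 3 set) = card {a, b}" by simp
    then show False by (simp add: card_insert_if split: if_splits)
  qed
  show "(UNIV :: 3 set) \<noteq> {a}" "(UNIV :: 3 set) \<noteq> {a, b}"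
    using *[of a a] *[of a b] by simp_all
qed

lemma hodge_one_form:
  "hodge (one_form F) p K =
     (if K = {2,3} then F p $ 1 else if K = {1,3} then - F p $ 2 else if K = {1,2} then F p $ 3 else 0)"
  using set3_cases[of K]
  by (elim insertE emptyE; simp only: hodge_def one_form_def;
      simp only: wsign_code Compl_3 sum_3 Compl_UNIV_eq Compl_empty_eq double_complement;
      simp add: doubleton_eq_iff UNIV_3_neq UNIV_3_neq[symmetric])

lemma wedge_hodge: "volume_coeff (\<alpha> \<^bold>\<and> hodge \<beta>) p = (\<Sum>I\<in>UNIV. \<alpha> p I * \<beta> p I)"
proof -
  have sign: "wsign I (- I) * wsign (- I) I = 1" for I
    using set3_cases[of I] by (auto simp: wsign_code)
  have "wsign I (- I) * \<alpha> p I * hodge \<beta> p (- I) = \<alpha> p I * \<beta> p I" for I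
  proof -
    have "wsign I (- I) * \<alpha> p I * hodge \<beta> p (- I) = (wsign I (- I) * wsign (- I) I) * (\<alpha> p I * \<beta> p I)"
      by (simp add: hodge_def)
    then show ?thesis by (simp add: sign)
  qed
  then have "wsign I (UNIV - I) * \<alpha> p I * hodge \<beta> p (UNIV - I) = \<alpha> p I * \<beta> p I" for I
    by (simp add: Compl_eq_Diff_UNIV)
  then show ?thesis
    by (simp only: volume_coeff_def wedge_def Pow_UNIV)
qed

lemma one_form_singleton: "one_form F p {i} = F p $ i"
  by (simp add: one_form_def)

lemma hodge_ext_d_one_form: "hodge (ext_d (one_form F)) = one_form (curl F)"
proof (intro ext)
  fix p K
  have diffs: "{2,3} - {2::3} = {3}" "{2,3} - {3::3} = {2}" "{1,3} - {1::3} = {3}"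
    "{1,3} - {3::3} = {1}" "{1,2} - {1::3} = {2}" "{1,2} - {2::3} = {1}"
    by auto
  have curl: "curl F p $ 1 = partial 2 (\<lambda>q. F q $ 3) p - partial 3 (\<lambda>q. F q $ 2) p"
    "curl F p $ 2 = partial 3 (\<lambda>q. F q $ 1) p - partial 1 (\<lambda>q. F q $ 3) p"
    "curl F p $ 3 = partial 1 (\<lambda>q. F q $ 2) p - partial 2 (\<lambda>q. F q $ 1) p"
    by (simp_all add: curl_def)
  have zero0: "one_form F q {} = 0" for q
    by (simp add: one_form_def)
  have zero2: "one_form F q (- {i}) = 0" for q i
    using exhaust_3[of i]
    by (elim disjE; simp only: one_form_def Compl_3 sum_3; simp add: doubleton_eq_iff)
  have "partial i (\<lambda>q. 0 :: complex) p = 0" for i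
    by (simp add: partial_def)
  then have no2: "ext_d (one_form F) p {i} = 0" "ext_d (one_form F) p UNIV = 0"
    "ext_d (one_form F) p {} = 0" for i
    by (simp_all add: ext_d_def zero0 zero2 Compl_eq_Diff_UNIV[symmetric])
  show "hodge (ext_d (one_form F)) p K = one_form (curl F) p K"
    using set3_cases[of K]
  proof (elim insertE emptyE)
    assume "K = {}" then show ?thesis by (simp add: hodge_def no2 one_form_def)
  next
    assume "K = UNIV" then show ?thesis by (simp add: hodge_def no2 one_form_def UNIV_3_neq)
  next
    assume K: "K = {1}" show ?thesis unfolding K hodge_def Compl_3
      by (simp add: ext_d_def diffs one_form_singleton wsign_code curl)
  next
    assume K: "K = {2}" show ?thesis unfolding K hodge_def Compl_3
      by (simp add: ext_d_def diffs one_form_singleton wsign_code curl)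
  next
    assume K: "K = {3}" show ?thesis unfolding K hodge_def Compl_3
      by (simp add: ext_d_def diffs one_form_singleton wsign_code curl)
  next
    assume K: "K = {1,2}" show ?thesis unfolding K hodge_def Compl_3
      by (simp add: no2 one_form_def sum_3 doubleton_eq_iff)
  next
    assume K: "K = {1,3}" show ?thesis unfolding K hodge_def Compl_3
      by (simp add: no2 one_form_def sum_3 doubleton_eq_iff)
  next
    assume K: "K = {2,3}" show ?thesis unfolding K hodge_def Compl_3
      by (simp add: no2 one_form_def sum_3 doubleton_eq_iff)
  qed
qed

end

(*
  The field J = X E is C^2 with compact support, and A = green * J. Since green is the fundamental
  solution of the Helmholtz operator, (Laplacian + k^2) A = J. This turns E^sc = k^2 A + grad div A into
  curl curl A = E^sc - J, so with s = mu_0 gamma_0 and B = s curl A we get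
  Einc + (1/s) curl B = E - J = (1 - X) E. On \<Omega> one has curl E = curl Einc + k^2 curl A, so the
  denominator is s (1 - X) E . curl E; and curl curl B - k^2 B = - s curl J, so the numerator is
  - s (1 - X) E . curl (X E) = - s (1 - X) X E . curl E, because E is orthogonal to grad X x E.

  The fundamental solution property is obtained by replacing |y| with sqrt (e^2 + |y|^2) in
  exp (i k |y|) / |y|: integration by parts needs no boundary terms for the regularised kernel, and
  its image under the Helmholtz operator is an explicit approximate identity. Derivatives of A always
  fall on J, so only local integrability of the kernel is needed.
*)

theory Submission
  imports Defs "HOL-Real_Asymp.Real_Asymp"
begin

section \<open>Partial derivatives and classes of differentiability\<close>

text \<open>Three obstacles shape the proof. The second derivatives of the kernel grow like |y|^-3
  at the origin, which is not integrable there, so the Helmholtz equation cannot be found by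
  differentiating the kernel twice. It is proved in weak form: convolving the kernel with (Laplacian
  + k^2) f returns f for every C^2 function f of bounded support.

  Next, curl Esc = k^2 curl A on \<Omega> rests on curl grad div A = 0, that is, on two continuous
  orders of derivatives of div A. Derivatives that fall on J supply only one. The second comes from
  the total field: on \<Omega> the gradient of div A equals Einc subtracted from E, less k^2 A, and
  this is C^1.

  Finally, \<open>partial\<close> and the Bochner integral are total: a partial derivative that does
  not exist is an unspecified vector, and the integral of a non-integrable function is 0. Hence
  rules that look purely algebraic carry differentiability or integrability, and so do their
  applications to A, of which nothing is known until it is recognised as a convolution.\<close>

lemma partial_eq_derivative:
  assumes "(f has_derivative f') (at p)"
  shows "partial i f p = f' (axis i 1)"
proof -
  have f: "(f has_derivative f') (at (p + 0 *\<^sub>R axis i 1))"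
    using assms by simp
  have "((\<lambda>t. f (p + t *\<^sub>R axis i 1)) has_derivative (\<lambda>t. f' (t *\<^sub>R axis i 1))) (at 0)"
    by (rule has_derivative_compose[where f = "\<lambda>t. p + t *\<^sub>R axis i 1" and x = 0, OF _ f]) (auto intro!: derivative_eq_intros)
  moreover have "f' (t *\<^sub>R axis i 1) = t *\<^sub>R f' (axis i 1)" for t
    using has_derivative_linear[OF assms] by (simp add: linear_scale)
  ultimately show ?thesis
    unfolding partial_def by (intro vector_derivative_at) (simp add: has_vector_derivative_def)
qed

lemma has_vector_derivative_along_axis:
  assumes "f differentiable at (q + t *\<^sub>R axis j 1)"
  shows "((\<lambda>t. f (q + t *\<^sub>R axis j 1)) has_vector_derivative partial j f (q + t *\<^sub>R axis j 1)) (at t within T)"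
proof -
  obtain f' where f': "(f has_derivative f') (at (q + t *\<^sub>R axis j 1))"
    using assms by (auto simp: differentiable_def)
  have "((\<lambda>t. f (q + t *\<^sub>R axis j 1)) has_derivative (\<lambda>t. f' (t *\<^sub>R axis j 1))) (at t within T)"
    by (rule has_derivative_compose[where f = "\<lambda>t. q + t *\<^sub>R axis j 1" and x = t, OF _ f']) (auto intro!: derivative_eq_intros)
  moreover have "f' (s *\<^sub>R axis j 1) = s *\<^sub>R f' (axis j 1)" for s
    using has_derivative_linear[OF f'] by (simp add: linear_scale)
  ultimately show ?thesis
    by (simp add: has_vector_derivative_def partial_eq_derivative[OF f'])
qed

lemma partial_cong:
  assumes "open S" "p \<in> S" "\<And>q. q \<in> S \<Longrightarrow> f q = g q"
  shows "partial i f p = partial i g p"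
proof -
  have "((\<lambda>t. p + t *\<^sub>R axis i (1::real)) \<longlongrightarrow> p + 0 *\<^sub>R axis i 1) (nhds 0)"
    by (intro tendsto_intros filterlim_ident)
  then have "\<forall>\<^sub>F t in nhds 0. p + t *\<^sub>R axis i 1 \<in> S"
    using assms(1,2) by (simp add: tendsto_def)
  then show ?thesis
    unfolding partial_def
    by (intro vector_derivative_cong_eq) (auto elim: eventually_mono simp: assms(3))
qed

lemma differentiable_on_openD:
  "f differentiable_on S \<Longrightarrow> open S \<Longrightarrow> p \<in> S \<Longrightarrow> f differentiable at p"
  by (metis at_within_open differentiable_on_def)

lemma Ck_on_cong:
  assumes "open S" "\<And>q. q \<in> S \<Longrightarrow> f q = g q"
  shows "Ck_on n S f \<longleftrightarrow> Ck_on n S g"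
  using assms(2)
proof (induction n arbitrary: f g)
  case 0
  then show ?case by (simp cong: continuous_on_cong)
next
  case (Suc n)
  have "f differentiable_on S \<longleftrightarrow> g differentiable_on S"
    unfolding differentiable_on_def using Suc.prems
    by (metis differentiable_transform_within zero_less_one)
  moreover have "Ck_on n S (partial i f) \<longleftrightarrow> Ck_on n S (partial i g)" for i
    by (intro Suc.IH partial_cong[OF assms(1)] Suc.prems)
  ultimately show ?case by simp
qed

lemma Ck_on_subset: "Ck_on n S f \<Longrightarrow> T \<subseteq> S \<Longrightarrow> Ck_on n T f"
  by (induction n arbitrary: f) (auto intro: continuous_on_subset differentiable_on_subset)

lemma Ck_on_SucD: "Ck_on (Suc n) S f \<Longrightarrow> Ck_on n S f"
  by (induction n arbitrary: f) (auto intro: differentiable_imp_continuous_on)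

lemma Ck_on_imp_continuous_on: "Ck_on n S f \<Longrightarrow> continuous_on S f"
  by (cases n) (auto intro: differentiable_imp_continuous_on)

text \<open>Serves to glue J = X E, which is regular on \<Omega> because E is, and regular off the
  support of X because it vanishes there.\<close>

lemma Ck_on_Un_open:
  assumes "open S" "open T" "Ck_on n S f" "Ck_on n T f"
  shows "Ck_on n (S \<union> T) f"
  using assms(3,4)
proof (induction n arbitrary: f)
  case 0
  then show ?case using assms(1,2) by (simp add: continuous_on_open_Un)
next
  case (Suc n)
  have "f differentiable at p" if "p \<in> S \<union> T" for p
    using Suc.prems assms(1,2) that by (auto dest: differentiable_on_openD)
  then show ?case
    using Suc by (auto intro: differentiable_at_imp_differentiable_on)
qed

section \<open>Rules of calculus for \<open>partial\<close> and closure properties of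
  \<open>Ck_on\<close>\<close>

lemma partial_bounded_linear:
  assumes "bounded_linear h" "f differentiable at p"
  shows "partial i (\<lambda>q. h (f q)) p = h (partial i f p)"
proof -
  obtain f' where f': "(f has_derivative f') (at p)"
    using assms by (auto simp: differentiable_def)
  from partial_eq_derivative[OF bounded_linear.has_derivative[OF assms(1) this]]
  show ?thesis by (simp add: partial_eq_derivative[OF f'])
qed

lemma partial_add:
  assumes "f differentiable at p" "g differentiable at p"
  shows "partial i (\<lambda>q. f q + g q) p = partial i f p + partial i g p"
proof -
  obtain f' g' where f': "(f has_derivative f') (at p)" and g': "(g has_derivative g') (at p)"
    using assms by (auto simp: differentiable_def)
  from partial_eq_derivative[OF has_derivative_add[OF this]]
  show ?thesis by (simp add: partial_eq_derivative[OF f'] partial_eq_derivative[OF g'])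
qed

lemma partial_diff:
  assumes "f differentiable at p" "g differentiable at p"
  shows "partial i (\<lambda>q. f q - g q) p = partial i f p - partial i g p"
proof -
  obtain f' g' where f': "(f has_derivative f') (at p)" and g': "(g has_derivative g') (at p)"
    using assms by (auto simp: differentiable_def)
  from partial_eq_derivative[OF has_derivative_diff[OF this]]
  show ?thesis by (simp add: partial_eq_derivative[OF f'] partial_eq_derivative[OF g'])
qed

lemma partial_sum:
  assumes "finite I" "\<And>k. k \<in> I \<Longrightarrow> f k differentiable at p"
  shows "partial i (\<lambda>q. \<Sum>k\<in>I. f k q) p = (\<Sum>k\<in>I. partial i (f k) p)"
proof -
  obtain f' where f': "\<And>k. k \<in> I \<Longrightarrow> (f k has_derivative f' k) (at p)"
    using assms(2) unfolding differentiable_def by metis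
  from partial_eq_derivative[OF has_derivative_sum[OF this]]
  show ?thesis by (simp add: partial_eq_derivative[OF f'])
qed

lemma partial_mult:
  fixes f g :: "real^3 \<Rightarrow> 'a::real_normed_algebra"
  assumes "f differentiable at p" "g differentiable at p"
  shows "partial i (\<lambda>q. f q * g q) p = f p * partial i g p + partial i f p * g p"
proof -
  obtain f' g' where f': "(f has_derivative f') (at p)" and g': "(g has_derivative g') (at p)"
    using assms by (auto simp: differentiable_def)
  from partial_eq_derivative[OF has_derivative_mult[OF this]]
  show ?thesis by (simp add: partial_eq_derivative[OF f'] partial_eq_derivative[OF g'])
qed

lemma partial_const [simp]: "partial i (\<lambda>q. c) p = 0"
  by (simp add: partial_def)

lemma Ck_on_const [simp]: "Ck_on n S (\<lambda>q. c)"
proof (induction n arbitrary: c)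
  case (Suc n)
  have "partial i (\<lambda>q. c) = (\<lambda>q. 0)" for i
    by (rule ext) simp
  with Suc show ?case by (simp add: differentiable_on_const)
qed simp

lemma Ck_on_bounded_linear:
  assumes "bounded_linear h" "open S" "Ck_on n S f"
  shows "Ck_on n S (\<lambda>q. h (f q))"
  using assms(3)
proof (induction n arbitrary: f)
  case 0
  then show ?case by (simp add: bounded_linear.continuous_on[OF assms(1)])
next
  case (Suc n)
  then have f: "f differentiable at p" if "p \<in> S" for p
    using assms(2) that by (auto dest: differentiable_on_openD)
  have "Ck_on n S (partial i (\<lambda>q. h (f q))) \<longleftrightarrow> Ck_on n S (\<lambda>q. h (partial i f q))" for i
    by (intro Ck_on_cong assms(2) partial_bounded_linear assms(1) f)
  moreover have "(\<lambda>q. h (f q)) differentiable at p" if "p \<in> S" for p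
    using f[OF that] bounded_linear.has_derivative[OF assms(1)] unfolding differentiable_def by blast
  ultimately show ?case
    using Suc by (auto intro: differentiable_at_imp_differentiable_on)
qed

lemma Ck_on_add:
  assumes "open S" "Ck_on n S f" "Ck_on n S g"
  shows "Ck_on n S (\<lambda>q. f q + g q)"
  using assms(2,3)
proof (induction n arbitrary: f g)
  case 0
  then show ?case by (simp add: continuous_on_add)
next
  case (Suc n)
  have "Ck_on n S (partial i (\<lambda>q. f q + g q)) \<longleftrightarrow> Ck_on n S (\<lambda>q. partial i f q + partial i g q)" for i
    using Suc.prems assms(1) by (intro Ck_on_cong partial_add) (auto dest: differentiable_on_openD)
  with Suc show ?case by (simp add: differentiable_on_add)
qed

lemma Ck_on_mult:
  fixes f g :: "real^3 \<Rightarrow> 'a::real_normed_algebra"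
  assumes "open S" "Ck_on n S f" "Ck_on n S g"
  shows "Ck_on n S (\<lambda>q. f q * g q)"
  using assms(2,3)
proof (induction n arbitrary: f g)
  case 0
  then show ?case by (simp add: continuous_on_mult)
next
  case (Suc n)
  have "Ck_on n S (partial i (\<lambda>q. f q * g q)) \<longleftrightarrow>
      Ck_on n S (\<lambda>q. f q * partial i g q + partial i f q * g q)" for i
    using Suc.prems assms(1) by (intro Ck_on_cong partial_mult) (auto dest: differentiable_on_openD)
  moreover have "Ck_on n S (\<lambda>q. f q * partial i g q + partial i f q * g q)" for i
    using Suc.prems by (intro Ck_on_add assms(1) Suc.IH) (auto intro: Ck_on_SucD)
  moreover have "(\<lambda>q. f q * g q) differentiable_on S"
    using Suc.prems by (simp add: differentiable_on_mult)
  ultimately show ?case by simp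
qed

lemma Ck_on_diff:
  assumes "open S" "Ck_on n S f" "Ck_on n S g"
  shows "Ck_on n S (\<lambda>q. f q - g q)"
  using Ck_on_add[OF assms(1,2) Ck_on_bounded_linear[OF bounded_linear_minus[OF bounded_linear_ident] assms(1,3)]]
  by simp

lemma Ck_on_cmult:
  fixes c :: "'a::real_normed_algebra"
  assumes "open S" "Ck_on n S f"
  shows "Ck_on n S (\<lambda>q. c * f q)"
  by (rule Ck_on_mult[OF assms(1) Ck_on_const assms(2)])

lemma Ck_on_sum:
  assumes "finite I" "open S" "\<And>k. k \<in> I \<Longrightarrow> Ck_on n S (f k)"
  shows "Ck_on n S (\<lambda>q. \<Sum>k\<in>I. f k q)"
  using assms(1,3)
proof (induction I rule: finite_induct)
  case (insert k I)
  then show ?case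
    using Ck_on_add[OF assms(2), of n "f k" "\<lambda>q. \<Sum>k\<in>I. f k q"] by simp
qed simp

section \<open>Symmetry of the mixed partial derivatives\<close>

lemma norm_increment_le:
  fixes \<phi> :: "real \<Rightarrow> 'a::real_normed_vector"
  assumes "\<And>t. t \<in> {0..h} \<Longrightarrow> (\<phi> has_vector_derivative \<phi>' t) (at t within {0..h})"
    and "\<And>t. t \<in> {0..h} \<Longrightarrow> norm (\<phi>' t) \<le> B" and "0 \<le> h"
  shows "norm (\<phi> h - \<phi> 0) \<le> B * h"
proof -
  have "norm (\<phi> h - \<phi> 0) \<le> B * norm (h - 0)"
  proof (rule differentiable_bound[where S = "{0..h}" and f' = "\<lambda>t s. s *\<^sub>R \<phi>' t"])
    fix t assume t: "t \<in> {0..h}"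
    show "(\<phi> has_derivative (\<lambda>s. s *\<^sub>R \<phi>' t)) (at t within {0..h})"
      using assms(1)[OF t] by (simp add: has_vector_derivative_def)
    show "onorm (\<lambda>s. s *\<^sub>R \<phi>' t) \<le> B"
      using assms(2)[OF t] by (intro onorm_le) (simp add: mult.commute[of B] mult_left_mono)
  qed (use assms(3) in auto)
  with assms(3) show ?thesis by simp
qed

text \<open>The second difference is symmetric in \<open>i\<close> and \<open>j\<close>, so
  estimating it by either mixed derivative makes the two agree. The mean value inequality is applied
  twice, along \<open>j\<close> to the increment of \<open>partial i f\<close> and then along
  \<open>i\<close> to the increment of \<open>f\<close>; an intermediate point is not to be had for
  vector values.\<close>

lemma second_difference_bound:
  fixes f :: "real^3 \<Rightarrow> 'a::real_normed_vector"
  assumes "open S" "p \<in> S" "Ck_on 2 S f" "0 < e"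
  shows "\<exists>d>0. \<forall>h. 0 < h \<longrightarrow> h < d \<longrightarrow>
    norm (f (p + h *\<^sub>R axis i 1 + h *\<^sub>R axis j 1) - f (p + h *\<^sub>R axis i 1) - f (p + h *\<^sub>R axis j 1) + f p
      - (h * h) *\<^sub>R partial j (partial i f) p) \<le> e * h * h"
proof -
  let ?g = "partial j (partial i f)" and ?ei = "axis i 1 :: real^3" and ?ej = "axis j 1 :: real^3"
  have f: "f differentiable at q" "partial i f differentiable at q" if "q \<in> S" for q
    using assms(1,3) that by (auto simp: numeral_2_eq_2 dest: differentiable_on_openD)
  have "continuous (at p) ?g"
    using assms by (simp add: numeral_2_eq_2 continuous_on_eq_continuous_at)
  then obtain r1 where r1: "r1 > 0" "\<And>q. dist q p < r1 \<Longrightarrow> dist (?g q) (?g p) < e"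
    using assms(4) unfolding continuous_at_eps_delta by blast
  obtain r2 where r2: "r2 > 0" "ball p r2 \<subseteq> S"
    using assms(1,2) openE by blast
  \<comment> \<open>The far corner of the square may be as far as 2 h from \<open>p\<close> (it is
    when i = j), hence the half.\<close>
  define d where "d = min r1 r2 / 2"
  have near: "dist (p + s *\<^sub>R ?ei + t *\<^sub>R ?ej) p < min r1 r2"
    if "0 \<le> s" "s \<le> h" "0 \<le> t" "t \<le> h" "h < d" for s t h
  proof -
    have "dist (p + s *\<^sub>R ?ei + t *\<^sub>R ?ej) p = norm (s *\<^sub>R ?ei + t *\<^sub>R ?ej)"
      by (simp add: dist_norm add.assoc)
    also have "\<dots> \<le> s + t"
      using norm_triangle_ineq[of "s *\<^sub>R ?ei" "t *\<^sub>R ?ej"] that by simp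
    finally show ?thesis using that by (simp add: d_def)
  qed
  have inS: "p + s *\<^sub>R ?ei + t *\<^sub>R ?ej \<in> S"
    if "0 \<le> s" "s \<le> h" "0 \<le> t" "t \<le> h" "h < d" for s t h
    using near[OF that] r2(2) by (auto simp: dist_commute mem_ball)
  have "norm (f (p + h *\<^sub>R ?ei + h *\<^sub>R ?ej) - f (p + h *\<^sub>R ?ei) - f (p + h *\<^sub>R ?ej) + f p
      - (h * h) *\<^sub>R ?g p) \<le> e * h * h" if h: "0 < h" "h < d" for h
  proof -
    have inner: "norm (partial i f (p + s *\<^sub>R ?ei + h *\<^sub>R ?ej) - partial i f (p + s *\<^sub>R ?ei) - h *\<^sub>R ?g p) \<le> e * h"
      if s: "s \<in> {0..h}" for s
    proof -
      \<comment> \<open>With the linear term removed, the derivative is the deviation of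
        \<open>?g\<close> from its value at \<open>p\<close>, which is below \<open>e\<close> by
        continuity. The function \<psi> below plays the same part along \<open>i\<close>, with
        \<open>inner\<close> as the bound on its derivative.\<close>
      define \<phi> where "\<phi> t = partial i f (p + s *\<^sub>R ?ei + t *\<^sub>R ?ej) - t *\<^sub>R ?g p" for t
      have "norm (\<phi> h - \<phi> 0) \<le> e * h"
      proof (rule norm_increment_le)
        fix t assume t: "t \<in> {0..h}"
        show "(\<phi> has_vector_derivative (?g (p + s *\<^sub>R ?ei + t *\<^sub>R ?ej) - ?g p)) (at t within {0..h})"
          unfolding \<phi>_def using s t h
          by (auto intro!: derivative_eq_intros has_vector_derivative_along_axis f inS[where h=h])
        show "norm (?g (p + s *\<^sub>R ?ei + t *\<^sub>R ?ej) - ?g p) \<le> e"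
          using r1(2)[of "p + s *\<^sub>R ?ei + t *\<^sub>R ?ej"] near[of s h t] s t h by (simp add: dist_norm)
      qed (use h in auto)
      then show ?thesis by (simp add: \<phi>_def algebra_simps)
    qed
    define \<psi> where "\<psi> s = f (p + h *\<^sub>R ?ej + s *\<^sub>R ?ei) - f (p + s *\<^sub>R ?ei) - s *\<^sub>R (h *\<^sub>R ?g p)" for s
    have "norm (\<psi> h - \<psi> 0) \<le> e * h * h"
    proof (rule norm_increment_le)
      fix s assume s: "s \<in> {0..h}"
      show "norm (partial i f (p + h *\<^sub>R ?ej + s *\<^sub>R ?ei) - partial i f (p + s *\<^sub>R ?ei) - h *\<^sub>R ?g p) \<le> e * h"
        using inner[OF s] by (simp add: algebra_simps)
      show "(\<psi> has_vector_derivative (partial i f (p + h *\<^sub>R ?ej + s *\<^sub>R ?ei)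
          - partial i f (p + s *\<^sub>R ?ei) - h *\<^sub>R ?g p)) (at s within {0..h})"
        unfolding \<psi>_def using s h inS[of s h h] inS[of s h 0]
        by (intro has_vector_derivative_diff has_vector_derivative_along_axis f)
          (auto intro!: derivative_eq_intros simp: add_ac)
    qed (use h in auto)
    then show ?thesis by (simp add: \<psi>_def algebra_simps)
  qed
  moreover have "d > 0" using r1(1) r2(1) by (simp add: d_def)
  ultimately show ?thesis by blast
qed

lemma partial_commute:
  fixes f :: "real^3 \<Rightarrow> 'a::real_normed_vector"
  assumes "open S" "p \<in> S" "Ck_on 2 S f"
  shows "partial i (partial j f) p = partial j (partial i f) p"
proof -
  let ?a = "partial i (partial j f) p" and ?b = "partial j (partial i f) p"
  have "norm (?a - ?b) \<le> e" if "e > 0" for e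
  proof -
    from that have "e / 2 > 0" by simp
    note bd = second_difference_bound[OF assms this]
    obtain d1 where d1: "d1 > 0" "\<And>h. 0 < h \<Longrightarrow> h < d1 \<Longrightarrow>
      norm (f (p + h *\<^sub>R axis i 1 + h *\<^sub>R axis j 1) - f (p + h *\<^sub>R axis i 1) - f (p + h *\<^sub>R axis j 1) + f p
        - (h * h) *\<^sub>R ?b) \<le> e / 2 * h * h"
      using bd[of i j] by blast
    obtain d2 where d2: "d2 > 0" "\<And>h. 0 < h \<Longrightarrow> h < d2 \<Longrightarrow>
      norm (f (p + h *\<^sub>R axis j 1 + h *\<^sub>R axis i 1) - f (p + h *\<^sub>R axis j 1) - f (p + h *\<^sub>R axis i 1) + f p
        - (h * h) *\<^sub>R ?a) \<le> e / 2 * h * h"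
      using bd[of j i] by blast
    define h where "h = min d1 d2 / 2"
    have h: "0 < h" "h < d1" "h < d2" using d1 d2 by (auto simp: h_def)
    have "(h * h) *\<^sub>R (?a - ?b) =
       (f (p + h *\<^sub>R axis i 1 + h *\<^sub>R axis j 1) - f (p + h *\<^sub>R axis i 1) - f (p + h *\<^sub>R axis j 1) + f p
        - (h * h) *\<^sub>R ?b) -
       (f (p + h *\<^sub>R axis j 1 + h *\<^sub>R axis i 1) - f (p + h *\<^sub>R axis j 1) - f (p + h *\<^sub>R axis i 1) + f p
        - (h * h) *\<^sub>R ?a)"
      by (simp add: algebra_simps)
    also have "norm \<dots> \<le> e / 2 * h * h + e / 2 * h * h"
      by (intro norm_triangle_le_diff add_mono d1(2) d2(2) h)
    finally have "\<bar>h * h\<bar> * norm (?a - ?b) \<le> e / 2 * h * h + e / 2 * h * h"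
      by (simp only: norm_scaleR)
    then have "(h * h) * norm (?a - ?b) \<le> (h * h) * e"
      by (simp add: algebra_simps)
    then show ?thesis using h(1) by simp
  qed
  then have "norm (?a - ?b) \<le> 0" by (rule field_le_epsilon) simp
  then show ?thesis by simp
qed

section \<open>Convolution with a locally integrable kernel\<close>

lemma integral_lborel_affine:
  fixes f :: "'a::euclidean_space \<Rightarrow> 'b::{banach, second_countable_topology}"
  assumes "c \<noteq> 0" and [measurable]: "f \<in> borel_measurable borel"
  shows "(\<integral>x. f x \<partial>lborel) = \<bar>c\<bar> ^ DIM('a) *\<^sub>R (\<integral>x. f (t + c *\<^sub>R x) \<partial>lborel)"
  by (subst lborel_affine[OF assms(1), of t]) (simp add: integral_density integral_distr)

lemma integral_lborel_reflect:
  fixes f :: "'a::euclidean_space \<Rightarrow> 'b::{banach, second_countable_topology}"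
  assumes "f \<in> borel_measurable borel"
  shows "(\<integral>x. f (p - x) \<partial>lborel) = (\<integral>x. f x \<partial>lborel)"
  using integral_lborel_affine[of "-1" f p] assms by simp

text \<open>The class is made for the Green's function, which is singular at the origin but
  integrable there, and decays too slowly to be integrable over the whole space.\<close>

definition locally_integrable :: "('a::euclidean_space \<Rightarrow> complex) \<Rightarrow> bool" where
  "locally_integrable g \<longleftrightarrow>
    g \<in> borel_measurable borel \<and> (\<forall>R. set_integrable lborel (cball 0 R) g)"

definition conv :: "('a::euclidean_space \<Rightarrow> complex) \<Rightarrow> ('a \<Rightarrow> complex) \<Rightarrow> 'a \<Rightarrow> complex" where
  "conv g f p = (\<integral>y. g y * f (p - y) \<partial>lborel)"

lemma locally_integrable_measurable: "locally_integrable g \<Longrightarrow> g \<in> borel_measurable borel"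
  by (simp add: locally_integrable_def)

lemma locally_integrable_continuous:
  assumes "continuous_on UNIV g"
  shows "locally_integrable g"
  unfolding locally_integrable_def set_integrable_def
proof (intro conjI allI)
  show "g \<in> borel_measurable borel"
    using assms by (rule borel_measurable_continuous_onI)
  show "integrable lborel (\<lambda>x. indicator (cball 0 R) x *\<^sub>R g x)" for R
    using continuous_on_subset[OF assms] by (intro borel_integrable_compact) auto
qed

lemma continuous_bounded_support_bound:
  fixes f :: "'a::euclidean_space \<Rightarrow> 'b::real_normed_vector"
  assumes "continuous_on UNIV f" "bounded {q. f q \<noteq> 0}"
  shows "\<exists>M. \<forall>q. norm (f q) \<le> M"
proof -
  have "compact (closure {q. f q \<noteq> 0})"
    using assms(2) by simp
  then have "bounded (f ` closure {q. f q \<noteq> 0})"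
    by (intro compact_imp_bounded compact_continuous_image continuous_on_subset[OF assms(1)]) auto
  then obtain M where M: "\<forall>x\<in>f ` closure {q. f q \<noteq> 0}. norm x \<le> M"
    unfolding bounded_iff by blast
  have "norm (f q) \<le> max M 0" for q
  proof (cases "f q = 0")
    case False
    then have "q \<in> closure {q. f q \<noteq> 0}"
      using closure_subset[of "{q. f q \<noteq> 0}"] by blast
    with M have "norm (f q) \<le> M" by blast
    then show ?thesis by linarith
  qed simp
  then show ?thesis by blast
qed

lemma locally_integrable_mult_dominated:
  assumes "locally_integrable g"
  shows "integrable lborel (\<lambda>y. M * norm (indicator (cball 0 R) y *\<^sub>R g y))"
  using assms unfolding locally_integrable_def set_integrable_def
  by (intro integrable_mult_right integrable_norm) auto

lemma integrable_locally_integrable_mult: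
  assumes g: "locally_integrable g" and f: "f \<in> borel_measurable borel"
    and M: "\<And>y. norm (f y) \<le> M" and R: "\<And>y. R < norm y \<Longrightarrow> f y = 0"
  shows "integrable lborel (\<lambda>y. g y * f y)"
proof (rule Bochner_Integration.integrable_bound[OF locally_integrable_mult_dominated[OF g, of M R]])
  show "(\<lambda>y. g y * f y) \<in> borel_measurable lborel"
    using locally_integrable_measurable[OF g] f by simp
  have "norm (g y * f y) \<le> norm (M * norm (indicator (cball 0 R) y *\<^sub>R g y))" for y
  proof (cases "norm y \<le> R")
    case True
    have "0 \<le> M" using M[of y] norm_ge_zero order_trans by blast
    with True show ?thesis
      using mult_left_mono[OF M[of y], of "norm (g y)"] by (simp add: norm_mult mult.commute)
  qed (simp add: R)
  then show "AE y in lborel. norm (g y * f y) \<le> norm (M * norm (indicator (cball 0 R) y *\<^sub>R g y))"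
    by simp
qed

lemma tendsto_integral_locally_integrable_mult:
  assumes g: "locally_integrable g"
    and F: "\<And>n. F n \<in> borel_measurable borel" and f: "f \<in> borel_measurable borel"
    and lim: "\<And>y. (\<lambda>n. F n y) \<longlonglongrightarrow> f y"
    and M: "\<And>n y. norm (F n y) \<le> M" and R: "\<And>n y. R < norm y \<Longrightarrow> F n y = 0"
  shows "(\<lambda>n. \<integral>y. g y * F n y \<partial>lborel) \<longlonglongrightarrow> (\<integral>y. g y * f y \<partial>lborel)"
proof (rule integral_dominated_convergence[OF _ _ locally_integrable_mult_dominated[OF g, of M R]])
  show "(\<lambda>y. g y * f y) \<in> borel_measurable lborel" "(\<lambda>y. g y * F n y) \<in> borel_measurable lborel" for n
    using locally_integrable_measurable[OF g] f F by simp_all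
  show "AE y in lborel. (\<lambda>n. g y * F n y) \<longlonglongrightarrow> g y * f y"
    by (intro AE_I2 tendsto_intros lim)
  have "norm (g y * F n y) \<le> M * norm (indicator (cball 0 R) y *\<^sub>R g y)" for y n
    using mult_left_mono[OF M[of n y], of "norm (g y)"]
    by (cases "norm y \<le> R") (simp_all add: norm_mult mult.commute R)
  then show "AE y in lborel. norm (g y * F n y) \<le> M * norm (indicator (cball 0 R) y *\<^sub>R g y)" for n
    by simp
qed

lemma continuous_on_reflect:
  fixes f :: "'a::real_normed_vector \<Rightarrow> 'b::topological_space"
  assumes "continuous_on UNIV f"
  shows "continuous_on UNIV (\<lambda>y. f (p - y))"
proof (rule continuous_on_compose2[OF assms])
  show "continuous_on UNIV (\<lambda>y. p - y)"
    by (intro continuous_intros)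
qed simp

lemma integrable_conv:
  assumes "locally_integrable g" "continuous_on UNIV f" "bounded {q. f q \<noteq> 0}"
  shows "integrable lborel (\<lambda>y. g y * f (p - y))"
proof -
  obtain M where M: "\<And>q. norm (f q) \<le> M"
    using continuous_bounded_support_bound[OF assms(2,3)] by blast
  obtain R where R: "\<And>q. f q \<noteq> 0 \<Longrightarrow> norm q \<le> R"
    using assms(3) unfolding bounded_iff by blast
  show ?thesis
  proof (rule integrable_locally_integrable_mult[OF assms(1)])
    show "(\<lambda>y. f (p - y)) \<in> borel_measurable borel"
      by (intro borel_measurable_continuous_onI continuous_on_reflect assms(2))
    show "norm (f (p - y)) \<le> M" for y by (rule M)
    show "f (p - y) = 0" if "norm p + R < norm y" for y
    proof (rule ccontr)
      assume "f (p - y) \<noteq> 0"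
      then have "norm (p - y) \<le> R" by (rule R)
      then show False
        using that norm_triangle_ineq2[of y p] norm_minus_commute[of y p] by linarith
    qed
  qed
qed

lemma conv_zero [simp]: "conv g (\<lambda>q. 0) p = 0"
  by (simp add: conv_def)

lemma conv_cmult: "conv g (\<lambda>q. c * f q) p = c * conv g f p"
  unfolding conv_def mult.left_commute[of _ c] by (rule integral_mult_right_zero)

lemma conv_add:
  assumes "locally_integrable g" "continuous_on UNIV f1" "bounded {q. f1 q \<noteq> 0}"
    "continuous_on UNIV f2" "bounded {q. f2 q \<noteq> 0}"
  shows "conv g (\<lambda>q. f1 q + f2 q) p = conv g f1 p + conv g f2 p"
  unfolding conv_def distrib_left
  by (intro Bochner_Integration.integral_add integrable_conv assms)

lemma conv_diff:
  assumes "locally_integrable g" "continuous_on UNIV f1" "bounded {q. f1 q \<noteq> 0}"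
    "continuous_on UNIV f2" "bounded {q. f2 q \<noteq> 0}"
  shows "conv g (\<lambda>q. f1 q - f2 q) p = conv g f1 p - conv g f2 p"
  unfolding conv_def right_diff_distrib
  by (intro Bochner_Integration.integral_diff integrable_conv assms)

lemma conv_sum:
  assumes "locally_integrable g"
    "\<And>k. k \<in> I \<Longrightarrow> continuous_on UNIV (f k)" "\<And>k. k \<in> I \<Longrightarrow> bounded {q. f k q \<noteq> 0}"
  shows "conv g (\<lambda>q. \<Sum>k\<in>I. f k q) p = (\<Sum>k\<in>I. conv g (f k) p)"
  unfolding conv_def sum_distrib_left
  by (rule Bochner_Integration.integral_sum) (intro integrable_conv assms)

section \<open>Differentiation of a convolution\<close>

lemma has_derivative_partials:
  assumes "f differentiable at p"
  shows "(f has_derivative (\<lambda>h. \<Sum>i\<in>UNIV. h $ i *\<^sub>R partial i f p)) (at p)"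
proof -
  obtain f' where f': "(f has_derivative f') (at p)"
    using assms by (auto simp: differentiable_def)
  interpret linear f' using has_derivative_linear[OF f'] .
  have "f' h = (\<Sum>i\<in>UNIV. h $ i *\<^sub>R partial i f p)" for h
  proof -
    have "f' h = f' (\<Sum>i\<in>UNIV. h $ i *\<^sub>R axis i 1)"
      using basis_expansion[of h] by (simp add: scalar_mult_eq_scaleR)
    then show ?thesis
      by (simp add: sum scale partial_eq_derivative[OF f'])
  qed
  then have "f' = (\<lambda>h. \<Sum>i\<in>UNIV. h $ i *\<^sub>R partial i f p)" by blast
  with f' show ?thesis by simp
qed

lemma norm_sum_components_le:
  fixes c :: "'n::finite \<Rightarrow> 'a::real_normed_vector"
  assumes "\<And>i. norm (c i) \<le> M i"
  shows "norm (\<Sum>i\<in>UNIV. (h::real^'n) $ i *\<^sub>R c i) \<le> (\<Sum>i\<in>UNIV. M i) * norm h"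
proof -
  have "norm (\<Sum>i\<in>UNIV. h $ i *\<^sub>R c i) \<le> (\<Sum>i\<in>UNIV. M i * norm h)"
  proof (rule sum_norm_le)
    fix i
    have "norm (h $ i *\<^sub>R c i) \<le> norm h * M i"
      unfolding norm_scaleR using component_le_norm_cart[of h i] assms[of i]
      by (intro mult_mono) auto
    then show "norm (h $ i *\<^sub>R c i) \<le> M i * norm h" by (simp add: mult.commute)
  qed
  then show ?thesis by (simp add: sum_distrib_right)
qed

text \<open>A derivative can be nonzero where \<open>f\<close> vanishes, but not off the closure of
  the support, since \<open>f\<close> is zero near every point there.\<close>

lemma bounded_support_partial:
  assumes "bounded {q. f q \<noteq> 0}"
  shows "bounded {q. partial i f q \<noteq> 0}"
proof -
  have "{q. partial i f q \<noteq> 0} \<subseteq> closure {q. f q \<noteq> 0}"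
  proof
    fix q assume q: "q \<in> {q. partial i f q \<noteq> 0}"
    show "q \<in> closure {q. f q \<noteq> 0}"
    proof (rule ccontr)
      assume "q \<notin> closure {q. f q \<noteq> 0}"
      then have "partial i f q = partial i (\<lambda>q. 0) q"
        using closure_subset[of "{q. f q \<noteq> 0}"]
        by (intro partial_cong[of "- closure {q. f q \<noteq> 0}"]) auto
      with q show False by simp
    qed
  qed
  with assms show ?thesis
    using bounded_closure bounded_subset by blast
qed

lemma C1_onD:
  assumes "Ck_on 1 S f"
  shows "f differentiable_on S" "continuous_on S f" "continuous_on S (partial i f)"
  using assms by (auto intro: differentiable_imp_continuous_on)

text \<open>The difference falls on \<open>f\<close>, so \<open>g\<close> is only integrated. What
  remains of the quotient after the linear part is removed tends to 0 pointwise, is bounded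
  uniformly and lives in one ball while the increment stays bounded: dominated convergence against
  \<open>g\<close> applies. The full derivative is established, and not just the partial ones,
  because \<open>Ck_on\<close> asks for differentiability.\<close>

lemma conv_has_derivative:
  assumes g: "locally_integrable g" and f: "Ck_on 1 UNIV f" "bounded {q. f q \<noteq> 0}"
  shows "(conv g f has_derivative (\<lambda>h. \<Sum>i\<in>UNIV. h $ i *\<^sub>R conv g (partial i f) p)) (at p)"
proof -
  have diff: "f differentiable at q" for q
    using f(1) by (auto dest: differentiable_on_openD)
  note der = has_derivative_partials[OF diff]
  have cont: "continuous_on UNIV f" "continuous_on UNIV (partial i f)" for i
    using C1_onD[OF f(1)] by auto
  note supp' = bounded_support_partial[OF f(2)]
  have "\<exists>M. \<forall>q. norm (partial i f q) \<le> M" for i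
    by (rule continuous_bounded_support_bound[OF cont(2) supp'])
  then obtain M where M: "\<And>i q. norm (partial i f q) \<le> M i" by metis
  define L where "L = (\<Sum>i\<in>UNIV. M i)"
  have lin: "norm (\<Sum>i\<in>UNIV. h $ i *\<^sub>R partial i f q) \<le> L * norm h" for h q
    unfolding L_def by (rule norm_sum_components_le) (rule M)
  have lip: "norm (f (q + h) - f q) \<le> L * norm h" for q h
    using differentiable_bound[of UNIV f "\<lambda>q h. \<Sum>i\<in>UNIV. h $ i *\<^sub>R partial i f q" L "q + h" q] der
    by (simp add: onorm_le lin)
  obtain R where R: "\<And>q. f q \<noteq> 0 \<or> (\<exists>i. partial i f q \<noteq> 0) \<Longrightarrow> norm q \<le> R"
  proof -
    have "bounded ({q. f q \<noteq> 0} \<union> (\<Union>i. {q. partial i f q \<noteq> 0}))"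
      using f(2) supp' by auto
    then show thesis using that unfolding bounded_iff by blast
  qed
  show ?thesis
  proof (unfold has_derivative_at, intro conjI)
    show "bounded_linear (\<lambda>h. \<Sum>i\<in>UNIV. h $ i *\<^sub>R conv g (partial i f) p)"
      by (intro bounded_linear_intros bounded_linear_scaleR_const bounded_linear_vec_nth)
    let ?D = "\<lambda>h. conv g f (p + h) - conv g f p - (\<Sum>i\<in>UNIV. h $ i *\<^sub>R conv g (partial i f) p)"
    let ?Q = "\<lambda>h q. (f (q + h) - f q - (\<Sum>i\<in>UNIV. h $ i *\<^sub>R partial i f q)) /\<^sub>R norm h"
    have D: "?D h /\<^sub>R norm h = (\<integral>y. g y * ?Q h (p - y) \<partial>lborel)" for h
    proof -
      have conv: "has_bochner_integral lborel (\<lambda>y. g y * F (x - y)) (conv g F x)"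
        if "continuous_on UNIV F" "bounded {q. F q \<noteq> 0}" for F x
        using integrable_conv[OF g that] by (simp add: has_bochner_integral_iff conv_def)
      have hb: "has_bochner_integral lborel (\<lambda>y. (g y * f (p + h - y) - g y * f (p - y)
          - (\<Sum>i\<in>UNIV. h $ i *\<^sub>R (g y * partial i f (p - y)))) /\<^sub>R norm h) (?D h /\<^sub>R norm h)"
        by (intro has_bochner_integral_scaleR_right has_bochner_integral_diff
            has_bochner_integral_sum conv cont f(2) supp')
      have eq: "(g y * f (p + h - y) - g y * f (p - y)
          - (\<Sum>i\<in>UNIV. h $ i *\<^sub>R (g y * partial i f (p - y)))) /\<^sub>R norm h = g y * ?Q h (p - y)" for y
        by (simp add: right_diff_distrib sum_distrib_left add_diff_eq diff_add_eq)
      have "has_bochner_integral lborel (\<lambda>y. g y * ?Q h (p - y)) (?D h /\<^sub>R norm h)"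
        using hb unfolding eq .
      then show ?thesis
        by (rule has_bochner_integral_integral_eq[symmetric])
    qed
    have "(\<lambda>n. ?D (X n) /\<^sub>R norm (X n)) \<longlonglongrightarrow> 0" if X: "X \<longlonglongrightarrow> 0" "\<And>n. X n \<noteq> 0" for X
    proof -
      have "Bseq X"
        by (intro convergent_imp_Bseq convergentI[OF X(1)])
      then obtain B where B: "\<And>n. norm (X n) \<le> B"
        unfolding Bseq_def by blast
      \<comment> \<open>The bound 2 L is L for the increment, by the Lipschitz estimate, and L for
        its linear part. Beyond the radius |p| + B + R both p - y and p - y + X n have norm above
        \<open>R\<close>, so that every term of \<open>?Q\<close> vanishes.\<close>
      have "(\<lambda>n. \<integral>y. g y * ?Q (X n) (p - y) \<partial>lborel) \<longlonglongrightarrow> (\<integral>y. g y * 0 \<partial>lborel)"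
      proof (rule tendsto_integral_locally_integrable_mult[where R = "norm p + B + R" and M = "2 * L", OF g])
        show "(\<lambda>y. ?Q (X n) (p - y)) \<in> borel_measurable borel" for n
        proof -
          have "continuous_on UNIV (\<lambda>y. f (p - y + X n))"
            using continuous_on_reflect[OF cont(1), of "p + X n"] by (simp add: diff_add_eq)
          then show ?thesis
            by (intro borel_measurable_continuous_onI continuous_intros
                continuous_on_reflect[OF cont(1)] continuous_on_reflect[OF cont(2)])
        qed
        show "(\<lambda>n. ?Q (X n) (p - y)) \<longlonglongrightarrow> 0" for y
        proof -
          have "((\<lambda>h. norm (f (p - y + h) - f (p - y) - (\<Sum>i\<in>UNIV. h $ i *\<^sub>R partial i f (p - y))) / norm h)
              \<longlongrightarrow> 0) (at 0)"
            using der[of "p - y"] by (simp add: has_derivative_at)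
          moreover have "filterlim X (at 0) sequentially"
            using X by (simp add: filterlim_at)
          ultimately have "(\<lambda>n. norm (f (p - y + X n) - f (p - y)
              - (\<Sum>i\<in>UNIV. X n $ i *\<^sub>R partial i f (p - y))) / norm (X n)) \<longlonglongrightarrow> 0"
            by (rule filterlim_compose)
          then have "(\<lambda>n. norm (?Q (X n) (p - y))) \<longlonglongrightarrow> 0"
            by (simp add: divide_inverse mult.commute)
          then show ?thesis by (simp only: tendsto_norm_zero_iff)
        qed
        show "norm (?Q (X n) (p - y)) \<le> 2 * L" for n y
        proof -
          have "norm (f (p - y + X n) - f (p - y) - (\<Sum>i\<in>UNIV. X n $ i *\<^sub>R partial i f (p - y)))
              \<le> L * norm (X n) + L * norm (X n)"
            by (intro norm_triangle_le_diff add_mono lip lin)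
          then have "norm (f (p - y + X n) - f (p - y) - (\<Sum>i\<in>UNIV. X n $ i *\<^sub>R partial i f (p - y)))
              / norm (X n) \<le> 2 * L"
            using X(2)[of n] by (simp add: pos_divide_le_eq)
          then show ?thesis by (simp add: divide_inverse mult.commute)
        qed
        show "?Q (X n) (p - y) = 0" if "norm p + B + R < norm y" for n y
        proof -
          have *: "R < norm (p - y)" "R < norm (p - y + X n)"
            using that B[of n] norm_triangle_ineq2[of y p] norm_minus_commute[of y p]
              norm_ge_zero[of "X n"] norm_diff_ineq[of "p - y" "X n"] by linarith+
          have "f (p - y) = 0" "f (p - y + X n) = 0" "partial i f (p - y) = 0" for i
            using R[of "p - y"] R[of "p - y + X n"] * by (meson not_le)+
          then show ?thesis by simp
        qed
      qed simp
      then show ?thesis by (simp only: D) simp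
    qed
    then have "((\<lambda>h. ?D h /\<^sub>R norm h) \<longlongrightarrow> 0) (at 0)"
      by (auto simp: tendsto_at_iff_sequentially o_def)
    from tendsto_norm[OF this]
    show "(\<lambda>h. norm (?D h) / norm h) \<midarrow>0\<rightarrow> 0"
      by (simp add: divide_inverse mult.commute)
  qed
qed

lemma conv_differentiable:
  assumes "locally_integrable g" "Ck_on 1 UNIV f" "bounded {q. f q \<noteq> 0}"
  shows "conv g f differentiable at p"
  using conv_has_derivative[OF assms] by (auto simp: differentiable_def)

lemma partial_conv:
  assumes "locally_integrable g" "Ck_on 1 UNIV f" "bounded {q. f q \<noteq> 0}"
  shows "partial i (conv g f) = conv g (partial i f)"
proof
  fix p
  show "partial i (conv g f) p = conv g (partial i f) p"
    using exhaust_3[of i] unfolding partial_eq_derivative[OF conv_has_derivative[OF assms]]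
    by (auto simp: sum_3 axis_def)
qed

text \<open>One order is spent because continuity of a convolution is drawn from its
  differentiability.\<close>

lemma Ck_on_conv:
  assumes "locally_integrable g" "Ck_on (Suc n) UNIV f" "bounded {q. f q \<noteq> 0}"
  shows "Ck_on n UNIV (conv g f)"
  using assms(2,3)
proof (induction n arbitrary: f)
  case 0
  then show ?case
    using conv_differentiable[OF assms(1), of f]
    by (auto intro!: differentiable_imp_continuous_on differentiable_at_imp_differentiable_on)
next
  case (Suc n)
  then have "Ck_on 1 UNIV f"
    by (auto intro: differentiable_imp_continuous_on)
  note f = assms(1) this Suc.prems(2)
  show ?case
    using Suc.prems
    by (auto simp: partial_conv[OF f] intro!: Suc.IH bounded_support_partial
        differentiable_at_imp_differentiable_on conv_differentiable[OF f])
qed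

text \<open>Translation invariance of the integral: convolving \<open>w\<close> with the constant 1
  gives a constant function of \<open>p\<close>. Its partial derivative is therefore 0, and it is
  also the convolution of 1 with \<open>partial i w\<close>.\<close>

lemma integral_partial_eq_0:
  assumes w: "Ck_on 1 UNIV w" "bounded {q. w q \<noteq> 0}"
  shows "(\<integral>y. partial i w y \<partial>lborel) = (0::complex)"
proof -
  have 1: "locally_integrable (\<lambda>_::real^3. 1)"
    by (intro locally_integrable_continuous continuous_intros)
  have w': "w \<in> borel_measurable borel" "partial i w \<in> borel_measurable borel"
    using C1_onD[OF w(1)] by (auto intro!: borel_measurable_continuous_onI)
  have "conv (\<lambda>_. 1) w = (\<lambda>p. \<integral>y. w y \<partial>lborel)"
    by (rule ext) (simp add: conv_def integral_lborel_reflect w')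
  then have "conv (\<lambda>_. 1) (partial i w) 0 = 0"
    by (simp flip: partial_conv[OF 1 w])
  then show ?thesis
    using integral_lborel_reflect[OF w'(2), of 0] by (simp add: conv_def)
qed

text \<open>Integration by parts for the product \<open>w\<close>. Its minus sign cancels the one
  from differentiating \<open>f (p - y)\<close> in \<open>y\<close>. The kernel has to be C^1 on the
  whole space, so this serves the regularised kernels and not \<open>green\<close>.\<close>

lemma conv_partial_swap:
  assumes g: "Ck_on 1 UNIV g" and f: "Ck_on 1 UNIV f" "bounded {q. f q \<noteq> 0}"
  shows "conv g (partial i f) p = conv (partial i g) f p"
proof -
  define w where "w y = g y * f (p - y)" for y
  have diff: "f differentiable at q" "g differentiable at q" for q
    using f(1) g by (auto dest: differentiable_on_openD)
  have cont: "continuous_on UNIV f" "continuous_on UNIV (partial i f)"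
     "continuous_on UNIV g" "continuous_on UNIV (partial i g)" for i
    using C1_onD[OF f(1)] C1_onD[OF g] by auto
  have der: "(w has_derivative (\<lambda>h. g q * (\<Sum>i\<in>UNIV. (- h) $ i *\<^sub>R partial i f (p - q)) +
      (\<Sum>i\<in>UNIV. h $ i *\<^sub>R partial i g q) * f (p - q))) (at q)" for q
    unfolding w_def
    by (rule has_derivative_mult[OF has_derivative_partials[OF diff(2)]
        has_derivative_compose[where f = "\<lambda>y. p - y", OF _ has_derivative_partials[OF diff(1)]]])
      (auto intro!: derivative_eq_intros)
  have w': "partial i w = (\<lambda>q. - (g q * partial i f (p - q)) + partial i g q * f (p - q))" for i
    using exhaust_3[of i] by (intro ext) (auto simp: partial_eq_derivative[OF der] sum_3 axis_def)
  have "continuous_on UNIV (partial i w)" for i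
    unfolding w' by (intro continuous_intros cont continuous_on_reflect[OF cont(1)]
        continuous_on_reflect[OF cont(2)])
  moreover have "w differentiable_on UNIV"
    using der by (meson differentiable_at_imp_differentiable_on differentiable_def)
  moreover obtain R where R: "\<And>q. f q \<noteq> 0 \<Longrightarrow> norm q \<le> R"
    using f(2) unfolding bounded_iff by blast
  have "norm q \<le> norm p + R" if "w q \<noteq> 0" for q
    using R[of "p - q"] that norm_triangle_ineq2[of q p] norm_minus_commute[of q p] by (simp add: w_def)
  then have "bounded {q. w q \<noteq> 0}"
    by (auto simp: bounded_iff)
  ultimately have "(\<integral>y. partial i w y \<partial>lborel) = 0"
    by (intro integral_partial_eq_0) auto
  also have "(\<integral>y. partial i w y \<partial>lborel) = - conv g (partial i f) p + conv (partial i g) f p"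
    unfolding w' conv_def
    by (subst Bochner_Integration.integral_add)
      (auto intro!: integrable_conv locally_integrable_continuous cont f bounded_support_partial)
  finally show ?thesis by simp
qed

section \<open>Integrals of radial functions\<close>

text \<open>Balls replace polar coordinates. Write f (|z|) as the integral of \<phi> over [|z|,
  \<infinity>) and exchange the integrals: for fixed \<open>s\<close> the points \<open>z\<close>
  form a ball of radius \<open>s\<close>, whose volume is that of the unit ball times s^DIM. What is
  left is a one-dimensional integral with primitive \<open>H\<close>.\<close>

lemma nn_integral_radial:
  fixes f \<phi> H :: "real \<Rightarrow> real"
  assumes [measurable]: "\<phi> \<in> borel_measurable borel"
    and f: "\<And>r. 0 < r \<Longrightarrow> (f has_real_derivative - \<phi> r) (at r)" "(f \<longlongrightarrow> 0) at_top"
    and \<phi>: "\<And>r. 0 \<le> r \<Longrightarrow> 0 \<le> \<phi> r"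
    and H: "\<And>r. 0 \<le> r \<Longrightarrow> (H has_real_derivative \<phi> r * r ^ DIM('a)) (at r)" "(H \<longlongrightarrow> T) at_top"
  shows "(\<integral>\<^sup>+z. ennreal (f (norm z)) \<partial>(lborel :: 'a::euclidean_space measure))
    = ennreal (unit_ball_vol DIM('a) * (T - H 0))"
proof -
  \<comment> \<open>The function \<open>f\<close> may be singular at 0, as in the application to 1 /
    (s w^3); the origin is a null set.\<close>
  have "AE z in lborel. (z::'a) \<noteq> 0"
    by (rule AE_lborel_singleton)
  then have "AE z in lborel. ennreal (f (norm (z::'a))) = (\<integral>\<^sup>+s. ennreal (\<phi> s) * indicator {norm z..} s \<partial>lborel)"
  proof (eventually_elim)
    case (elim z)
    have "(\<integral>\<^sup>+s. ennreal (\<phi> s) * indicator {norm z..} s \<partial>lborel) = ennreal (0 - (- f (norm z)))"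
    proof (rule nn_integral_FTC_atLeast[where F = "\<lambda>s. - f s"])
      show "((\<lambda>s. - f s) has_real_derivative \<phi> s) (at s)" if "norm z \<le> s" for s
        using DERIV_minus[OF f(1), of s] that elim by (simp add: less_le_trans[of 0 "norm z"])
      show "0 \<le> \<phi> s" if "norm z \<le> s" for s
        using \<phi>[of s] that norm_ge_zero[of z] by linarith
      show "((\<lambda>s. - f s) \<longlongrightarrow> 0) at_top"
        using tendsto_minus[OF f(2)] by simp
    qed simp
    then show ?case by simp
  qed
  then have "(\<integral>\<^sup>+z. ennreal (f (norm z)) \<partial>(lborel :: 'a measure)) =
      (\<integral>\<^sup>+z. (\<integral>\<^sup>+s. ennreal (\<phi> s) * indicator {norm z..} s \<partial>lborel) \<partial>(lborel :: 'a measure))"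
    by (rule nn_integral_cong_AE)
  also have "\<dots> = (\<integral>\<^sup>+s. (\<integral>\<^sup>+z. ennreal (\<phi> s) * indicator {norm (z::'a)..} s \<partial>lborel) \<partial>lborel)"
  proof (rule lborel_pair.Fubini'[symmetric])
    have "(\<lambda>(z, s). ennreal (\<phi> s) * indicator {norm (z::'a)..} s)
        = (\<lambda>p. ennreal (\<phi> (snd p)) * indicator {p. norm (fst p) \<le> snd p} p)"
      by (auto simp: fun_eq_iff indicator_def)
    also have "\<dots> \<in> borel_measurable (lborel \<Otimes>\<^sub>M lborel)"
      by measurable
    finally show "(\<lambda>(z, s). ennreal (\<phi> s) * indicator {norm (z::'a)..} s) \<in> borel_measurable (lborel \<Otimes>\<^sub>M lborel)" .
  qed
  also have "\<dots> = (\<integral>\<^sup>+s. ennreal (unit_ball_vol DIM('a) * (\<phi> s * s ^ DIM('a))) * indicator {0..} s \<partial>lborel)"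
  proof (rule nn_integral_cong)
    fix s :: real
    have "(\<integral>\<^sup>+z. ennreal (\<phi> s) * indicator {norm (z::'a)..} s \<partial>lborel)
        = (\<integral>\<^sup>+z. ennreal (\<phi> s) * indicator (cball (0::'a) s) z \<partial>lborel)"
      by (intro nn_integral_cong) (auto simp: indicator_def)
    also have "\<dots> = ennreal (\<phi> s) * emeasure lborel (cball (0::'a) s)"
      by (rule nn_integral_cmult_indicator) simp
    also have "\<dots> = ennreal (unit_ball_vol DIM('a) * (\<phi> s * s ^ DIM('a))) * indicator {0..} s"
    proof (cases "0 \<le> s")
      case True
      then show ?thesis using \<phi>[of s]
        by (simp add: emeasure_cball ennreal_mult'[symmetric] mult_ac)
    qed simp
    finally show "(\<integral>\<^sup>+z. ennreal (\<phi> s) * indicator {norm (z::'a)..} s \<partial>lborel)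
      = ennreal (unit_ball_vol DIM('a) * (\<phi> s * s ^ DIM('a))) * indicator {0..} s" .
  qed
  also have "\<dots> = ennreal (unit_ball_vol DIM('a) * T - unit_ball_vol DIM('a) * H 0)"
  proof (rule nn_integral_FTC_atLeast)
    show "((\<lambda>s. unit_ball_vol DIM('a) * H s) has_real_derivative unit_ball_vol DIM('a) * (\<phi> s * s ^ DIM('a))) (at s)"
      if "0 \<le> s" for s
      by (rule DERIV_cmult[OF H(1)[OF that]])
    show "0 \<le> unit_ball_vol DIM('a) * (\<phi> s * s ^ DIM('a))" if "0 \<le> s" for s
      using \<phi>[OF that] that by (simp add: unit_ball_vol_nonneg)
    show "((\<lambda>s. unit_ball_vol DIM('a) * H s) \<longlongrightarrow> unit_ball_vol DIM('a) * T) at_top"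
      by (rule tendsto_mult_left[OF H(2)])
  qed simp
  finally show ?thesis by (simp add: right_diff_distrib)
qed

text \<open>Polymorphic on purpose: on the reals it is also its own radial profile,
  \<open>soft_norm e (norm y) = soft_norm e y\<close>, so that one-dimensional calculus
  applies.\<close>

definition soft_norm :: "real \<Rightarrow> 'a::real_normed_vector \<Rightarrow> real" where
  "soft_norm e y = sqrt (e\<^sup>2 + (norm y)\<^sup>2)"

lemma soft_norm_pos: "0 < e \<Longrightarrow> 0 < soft_norm e y"
  by (simp add: soft_norm_def add_pos_nonneg)

lemma norm_le_soft_norm: "norm y \<le> soft_norm e y"
  unfolding soft_norm_def by (intro real_le_rsqrt) simp

lemma soft_norm_ge_1: "1 \<le> soft_norm 1 y"
  by (simp add: soft_norm_def)

lemma power2_soft_norm: "(soft_norm e y)\<^sup>2 = e\<^sup>2 + (norm y)\<^sup>2"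
  by (simp add: soft_norm_def)

lemma soft_norm_le: "0 \<le> e \<Longrightarrow> soft_norm e y \<le> e + norm y"
  unfolding soft_norm_def using sqrt_add_le_add_sqrt[of "e\<^sup>2" "(norm y)\<^sup>2"] by simp

lemma continuous_on_soft_norm [continuous_intros]:
  "continuous_on S f \<Longrightarrow> continuous_on S (\<lambda>x. soft_norm e (f x))"
  unfolding soft_norm_def by (intro continuous_intros)

lemma has_real_derivative_soft_norm:
  assumes "0 < e"
  shows "((soft_norm e :: real \<Rightarrow> real) has_real_derivative s / soft_norm e s) (at s)"
proof -
  have "0 < e\<^sup>2 + s\<^sup>2" using assms by (simp add: add_pos_nonneg)
  then have "((\<lambda>s. sqrt (e\<^sup>2 + s\<^sup>2)) has_real_derivative s / sqrt (e\<^sup>2 + s\<^sup>2)) (at s)"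
    by (auto intro!: derivative_eq_intros simp: divide_simps)
  then show ?thesis unfolding soft_norm_def[abs_def] by simp
qed

text \<open>A majorant for two tasks. Near 0 it behaves like 1 / |z| and dominates the Green's
  function on balls; at infinity it behaves like |z|^-4 and dominates the rescaled
  \<open>wave2\<close>. With the factor 1 / |z| in place of a fourth power of the soft norm the
  primitive \<open>?H\<close> is algebraic; otherwise it would contain an arctangent.\<close>

lemma integrable_radial_dominant:
  "integrable lborel (\<lambda>z::real^3. 1 / (norm z * soft_norm 1 z ^ 3))"
proof (rule integrableI_nonneg)
  let ?w = "\<lambda>s::real. soft_norm 1 s"
  let ?f = "\<lambda>s::real. 1 / (s * ?w s ^ 3)"
  let ?\<phi> = "\<lambda>s::real. 1 / (s\<^sup>2 * ?w s ^ 3) + 3 / ?w s ^ 5"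
  let ?H = "\<lambda>s::real. - (s\<^sup>2 / ?w s ^ 3) - 3 / ?w s"
  have w: "?w s > 0" for s by (rule soft_norm_pos) simp
  note w' = has_real_derivative_soft_norm[of 1, simplified]
  have "(\<integral>\<^sup>+z. ennreal (?f (norm z)) \<partial>(lborel :: (real^3) measure))
      = ennreal (unit_ball_vol DIM(real^3) * (0 - ?H 0))"
  proof (rule nn_integral_radial)
    show "?\<phi> \<in> borel_measurable borel"
      unfolding soft_norm_def by measurable
    show "(?f has_real_derivative - ?\<phi> r) (at r)" if "0 < r" for r
      using that w[of r]
      by (auto intro!: derivative_eq_intros w' simp: divide_simps) (simp add: algebra_simps eval_nat_numeral)
    show "(?f \<longlongrightarrow> 0) at_top"
      unfolding soft_norm_def real_norm_def by real_asymp
    show "0 \<le> ?\<phi> r" for r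
      using w[of r] by simp
    show "(?H has_real_derivative ?\<phi> r * r ^ DIM(real^3)) (at r)" for r
    proof -
      have "((\<lambda>s. s\<^sup>2 / ?w s ^ 3) has_real_derivative 2 * r / ?w r ^ 3 - 3 * r ^ 3 / ?w r ^ 5) (at r)"
        using w[of r]
        by (auto intro!: derivative_eq_intros w' simp: divide_simps) (simp add: algebra_simps eval_nat_numeral)
      moreover have "((\<lambda>s. 3 / ?w s) has_real_derivative - 3 * r / ?w r ^ 3) (at r)"
        using w[of r]
        by (auto intro!: derivative_eq_intros w' simp: divide_simps) (simp add: algebra_simps eval_nat_numeral)
      ultimately have "(?H has_real_derivative
          - (2 * r / ?w r ^ 3 - 3 * r ^ 3 / ?w r ^ 5) - - 3 * r / ?w r ^ 3) (at r)"
        by (intro DERIV_diff DERIV_minus)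
      \<comment> \<open>At r = 0 the singular term of \<open>?\<phi>\<close> has the default value 0
        of a division by zero, and both sides vanish.\<close>
      moreover have "?\<phi> r * r ^ DIM(real^3) =
          - (2 * r / ?w r ^ 3 - 3 * r ^ 3 / ?w r ^ 5) - - 3 * r / ?w r ^ 3"
        using w[of r] by (cases "r = 0") (simp_all add: field_simps eval_nat_numeral)
      ultimately show ?thesis by (simp only:)
    qed
    show "(?H \<longlongrightarrow> 0) at_top"
      unfolding soft_norm_def real_norm_def by real_asymp
  qed
  then show "(\<integral>\<^sup>+z. ennreal (1 / (norm z * soft_norm 1 z ^ 3)) \<partial>(lborel :: (real^3) measure)) < \<infinity>"
    by (simp add: soft_norm_def)
  show "(\<lambda>z::real^3. 1 / (norm z * soft_norm 1 z ^ 3)) \<in> borel_measurable lborel"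
    unfolding soft_norm_def by measurable
qed (simp add: soft_norm_def)

text \<open>This gives 3 / w^5 the total mass 4 pi, which matches the factor 1 / (4 pi) in
  \<open>green\<close>. The primitive is found from (s / w)' = 1 / w^3, which makes 5 s^4 / w^7 the
  derivative of (s / w)^5.\<close>

lemma integral_soft_norm_power5:
  "(\<integral>z. 1 / soft_norm 1 z ^ 5 \<partial>(lborel :: (real^3) measure)) = 4 / 3 * pi"
proof -
  let ?w = "\<lambda>s::real. soft_norm 1 s"
  have w: "?w s > 0" for s by (rule soft_norm_pos) simp
  note w' = has_real_derivative_soft_norm[of 1, simplified]
  have w2: "?w s * ?w s = 1 + s * s" for s
    using power2_soft_norm[of 1 s] by (simp add: power2_eq_square)
  have "(\<integral>\<^sup>+z. ennreal (1 / ?w (norm z) ^ 5) \<partial>(lborel :: (real^3) measure))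
      = ennreal (unit_ball_vol DIM(real^3) * (1 - (0 / ?w 0) ^ 5))"
  proof (rule nn_integral_radial[where f = "\<lambda>s. 1 / ?w s ^ 5" and \<phi> = "\<lambda>s. 5 * s / ?w s ^ 7" and H = "\<lambda>s. (s / ?w s) ^ 5"])
    show "(\<lambda>s. 5 * s / ?w s ^ 7) \<in> borel_measurable borel"
      unfolding soft_norm_def by measurable
    show "((\<lambda>s. 1 / ?w s ^ 5) has_real_derivative - (5 * r / ?w r ^ 7)) (at r)" for r
      using w[of r]
      by (auto intro!: derivative_eq_intros w' simp: divide_simps) (simp add: algebra_simps eval_nat_numeral)
    show "((\<lambda>s. 1 / ?w s ^ 5) \<longlongrightarrow> 0) at_top"
      unfolding soft_norm_def real_norm_def by real_asymp
    show "0 \<le> 5 * r / ?w r ^ 7" if "0 \<le> r" for r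
      using w[of r] that by simp
    show "((\<lambda>s. (s / ?w s) ^ 5) has_real_derivative 5 * r / ?w r ^ 7 * r ^ DIM(real^3)) (at r)" for r
    proof -
      have "(?w r - r * (r / ?w r)) / (?w r * ?w r) = 1 / ?w r ^ 3"
        using w[of r] w2[of r] by (simp add: divide_simps eval_nat_numeral)
      then have "((\<lambda>s. s / ?w s) has_real_derivative 1 / ?w r ^ 3) (at r)"
        using w[of r] by (auto intro!: derivative_eq_intros w')
      from DERIV_power[OF this, of 5] show ?thesis
        by (rule DERIV_cong) (use w[of r] in \<open>simp add: divide_simps eval_nat_numeral\<close>)
    qed
    show "((\<lambda>s. (s / ?w s) ^ 5) \<longlongrightarrow> 1) at_top"
      unfolding soft_norm_def real_norm_def by real_asymp
  qed
  moreover have "?w (norm z) = soft_norm 1 z" for z :: "real^3"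
    by (simp add: soft_norm_def)
  ultimately have "(\<integral>\<^sup>+z. ennreal (1 / soft_norm 1 z ^ 5) \<partial>(lborel :: (real^3) measure)) = ennreal (4 / 3 * pi)"
    by (simp add: unit_ball_vol_3)
  moreover have "(\<lambda>z::real^3. 1 / soft_norm 1 z ^ 5) \<in> borel_measurable lborel"
    unfolding soft_norm_def by measurable
  ultimately show ?thesis
    by (subst integral_eq_nn_integral) (auto simp: soft_norm_def)
qed

section \<open>The fundamental solution of the Helmholtz operator\<close>

lemma has_derivative_soft_norm:
  fixes y :: "'a::real_inner"
  assumes "0 < e"
  shows "(soft_norm e has_derivative (\<lambda>h. (y \<bullet> h) / soft_norm e y)) (at y)"
proof -
  have "0 < e\<^sup>2 + y \<bullet> y" using assms by (simp add: add_pos_nonneg)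
  then have "((\<lambda>y. sqrt (e\<^sup>2 + y \<bullet> y)) has_derivative (\<lambda>h. (y \<bullet> h) / sqrt (e\<^sup>2 + y \<bullet> y))) (at y)"
    by (auto intro!: derivative_eq_intros simp: inner_commute divide_simps)
  then show ?thesis
    unfolding soft_norm_def[abs_def] by (simp add: power2_norm_eq_inner)
qed

text \<open>The gradient of the soft norm is y divided by the soft norm. Writing P' as s Q cancels
  this denominator and leaves y times a radial function, to which the rule applies again.\<close>

lemma has_derivative_soft_radial:
  fixes y :: "real^3" and P :: "real \<Rightarrow> complex"
  assumes "0 < e" and P: "\<And>s. 0 < s \<Longrightarrow> (P has_vector_derivative s *\<^sub>R Q s) (at s)"
  shows "((\<lambda>y. P (soft_norm e y)) has_derivative (\<lambda>h. (y \<bullet> h) *\<^sub>R Q (soft_norm e y))) (at y)"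
proof -
  have pos: "0 < soft_norm e y" by (rule soft_norm_pos[OF assms(1)])
  have "((\<lambda>y. P (soft_norm e y)) has_derivative
      (\<lambda>h. ((y \<bullet> h) / soft_norm e y) *\<^sub>R (soft_norm e y *\<^sub>R Q (soft_norm e y)))) (at y)"
    using has_derivative_compose[OF has_derivative_soft_norm[OF assms(1)]
        P[OF pos, unfolded has_vector_derivative_def]] .
  then show ?thesis using pos by simp
qed

lemma partial_soft_radial:
  fixes P :: "real \<Rightarrow> complex"
  assumes "0 < e" and P: "\<And>s. 0 < s \<Longrightarrow> (P has_vector_derivative s *\<^sub>R Q s) (at s)"
  shows "partial i (\<lambda>y. P (soft_norm e y)) = (\<lambda>y. of_real (y $ i) * Q (soft_norm e y))"
proof
  fix y
  show "partial i (\<lambda>y. P (soft_norm e y)) y = of_real (y $ i) * Q (soft_norm e y)"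
    by (simp add: partial_eq_derivative[OF has_derivative_soft_radial[OF assms]] inner_axis
        scaleR_conv_of_real)
qed

lemma Ck_on_bounded_linear_map:
  assumes "bounded_linear h"
  shows "Ck_on n S h"
proof -
  have "(h has_derivative h) (at p within T)" for p T
    by (rule bounded_linear_imp_has_derivative[OF assms])
  then have "partial i h = (\<lambda>p. h (axis i 1))" "h differentiable_on S" for i
    by (auto simp: partial_eq_derivative differentiable_on_def differentiable_def)
  then show ?thesis
    by (cases n) (auto intro: differentiable_imp_continuous_on)
qed

lemma bounded_linear_coordinate: "bounded_linear (\<lambda>y::real^3. of_real (y $ i) :: complex)"
  by (rule bounded_linear_compose[OF bounded_linear_of_real bounded_linear_vec_nth])

lemma C1_soft_radial:
  fixes P :: "real \<Rightarrow> complex"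
  assumes "0 < e" and P: "\<And>s. 0 < s \<Longrightarrow> (P has_vector_derivative s *\<^sub>R Q s) (at s)"
    and Q: "continuous_on {0<..} Q"
  shows "Ck_on 1 UNIV (\<lambda>y. P (soft_norm e y))"
proof -
  have "continuous_on UNIV (\<lambda>y::real^3. Q (soft_norm e y))"
    using soft_norm_pos[OF assms(1)]
    by (intro continuous_on_compose2[OF Q] continuous_intros) auto
  then have "continuous_on UNIV (\<lambda>y::real^3. of_real (y $ i) * Q (soft_norm e y))" for i
    by (intro continuous_intros)
  moreover have "(\<lambda>y::real^3. P (soft_norm e y)) differentiable_on UNIV"
    using has_derivative_soft_radial[OF assms(1,2)]
    by (meson differentiable_at_imp_differentiable_on differentiable_def)
  ultimately show ?thesis
    by (simp add: partial_soft_radial[OF assms(1,2)])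
qed

text \<open>The profiles of the spherical wave \<open>exp (i k s) / s\<close> and of its images under the operator
  \<open>P \<mapsto> P' / s\<close>, which is how a gradient acts on a radial function.\<close>

definition wave0 :: "real \<Rightarrow> real \<Rightarrow> complex" where
  "wave0 k s = exp (\<i> * of_real (k * s)) * (1 / of_real s)"

definition wave1 :: "real \<Rightarrow> real \<Rightarrow> complex" where
  "wave1 k s = exp (\<i> * of_real (k * s)) * ((\<i> * of_real k * of_real s - 1) / of_real s ^ 3)"

definition wave2 :: "real \<Rightarrow> real \<Rightarrow> complex" where
  "wave2 k s = exp (\<i> * of_real (k * s)) *
     (3 / of_real s ^ 5 - 3 * \<i> * of_real k / of_real s ^ 4 - of_real k ^ 2 / of_real s ^ 3)"

lemma wave0_derivative:
  assumes "0 < s"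
  shows "(wave0 k has_vector_derivative s *\<^sub>R wave1 k s) (at s)"
proof -
  have "((\<lambda>z. exp (\<i> * (of_real k * z)) * (1 / z)) has_field_derivative of_real s * wave1 k s) (at (of_real s))"
    using assms unfolding wave1_def
    by (auto intro!: derivative_eq_intros simp: divide_simps) (simp add: algebra_simps eval_nat_numeral)
  from has_vector_derivative_real_field[OF this] show ?thesis
    unfolding wave0_def[abs_def] by (simp add: scaleR_conv_of_real)
qed

lemma wave1_derivative:
  assumes "0 < s"
  shows "(wave1 k has_vector_derivative s *\<^sub>R wave2 k s) (at s)"
proof -
  have "((\<lambda>z. exp (\<i> * (of_real k * z)) * ((\<i> * of_real k * z - 1) / z ^ 3))
      has_field_derivative of_real s * wave2 k s) (at (of_real s))"
    using assms unfolding wave2_def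
    by (auto intro!: derivative_eq_intros simp: divide_simps) (simp add: algebra_simps eval_nat_numeral)
  from has_vector_derivative_real_field[OF this] show ?thesis
    unfolding wave1_def[abs_def] by (simp add: scaleR_conv_of_real)
qed

text \<open>The Helmholtz equation of the spherical wave, written for its profiles: two derivatives
  of a radial function sum up to |y|^2 times the second profile plus 3 times the first, where 3 is
  the dimension.\<close>

lemma wave_recurrence:
  assumes "0 < s"
  shows "3 * wave1 k s + of_real (s\<^sup>2) * wave2 k s = - (of_real (k\<^sup>2) * wave0 k s)"
  using assms unfolding wave0_def wave1_def wave2_def
  by (simp add: divide_simps) (simp add: algebra_simps eval_nat_numeral)

lemma continuous_on_wave:
  "continuous_on {0<..} (wave0 k)" "continuous_on {0<..} (wave1 k)" "continuous_on {0<..} (wave2 k)"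
  unfolding wave0_def wave1_def wave2_def by (intro continuous_intros; simp)+

lemma continuous_on_wave_soft_norm:
  assumes "0 < e"
  shows "continuous_on UNIV (\<lambda>y::real^3. wave0 k (soft_norm e y))"
    "continuous_on UNIV (\<lambda>y::real^3. wave1 k (soft_norm e y))"
    "continuous_on UNIV (\<lambda>y::real^3. wave2 k (soft_norm e y))"
  using soft_norm_pos[OF assms]
  by (intro continuous_on_compose2[OF continuous_on_wave(1)] continuous_on_compose2[OF continuous_on_wave(2)]
      continuous_on_compose2[OF continuous_on_wave(3)] continuous_intros; auto)+

definition laplacian :: "(real^3 \<Rightarrow> complex) \<Rightarrow> real^3 \<Rightarrow> complex" where
  "laplacian f p = (\<Sum>i\<in>UNIV. partial i (partial i f) p)"

text \<open>For positive \<open>e\<close> the kernel is smooth enough for both derivatives to be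
  moved onto it. There the Helmholtz equation holds up to one explicit defect, which becomes the
  approximate identity.\<close>

lemma conv_regularised_wave:
  assumes e: "0 < e" and f: "Ck_on 2 UNIV f" "bounded {q. f q \<noteq> 0}"
  shows "conv (\<lambda>y. wave0 k (soft_norm e y)) (\<lambda>q. laplacian f q + of_real (k\<^sup>2) * f q) p
    = - (of_real (e\<^sup>2) * conv (\<lambda>y. wave2 k (soft_norm e y)) f p)"
proof -
  let ?w0 = "\<lambda>y::real^3. wave0 k (soft_norm e y)" and ?w1 = "\<lambda>y::real^3. wave1 k (soft_norm e y)"
    and ?w2 = "\<lambda>y::real^3. wave2 k (soft_norm e y)"
  note w = continuous_on_wave_soft_norm[OF e, of k]
  have f1: "Ck_on 1 UNIV f" "Ck_on 1 UNIV (partial i f)" for i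
    using f(1) Ck_on_SucD[of 1 UNIV f] by (auto simp: numeral_2_eq_2)
  have cont: "continuous_on UNIV f" "continuous_on UNIV (partial i (partial i f))" for i
    using C1_onD[OF f1(1)] C1_onD[OF f1(2)] by auto
  note supp' = bounded_support_partial[OF f(2)]
  note supp'' = bounded_support_partial[OF supp']
  have C1: "Ck_on 1 UNIV ?w0" "Ck_on 1 UNIV (\<lambda>y::real^3. of_real (y $ i) * ?w1 y)" for i
    by (intro Ck_on_mult open_UNIV Ck_on_bounded_linear_map[OF bounded_linear_coordinate]
        C1_soft_radial[OF e wave0_derivative continuous_on_wave(2)]
        C1_soft_radial[OF e wave1_derivative continuous_on_wave(3)]; assumption)+
  have w0': "partial i ?w0 = (\<lambda>y. of_real (y $ i) * ?w1 y)" for i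
    by (rule partial_soft_radial[OF e wave0_derivative])
  have w0'': "partial i (partial i ?w0) = (\<lambda>y. of_real (y $ i) ^ 2 * ?w2 y + ?w1 y)" for i
  proof
    fix y
    have "(\<lambda>y::real^3. complex_of_real (y $ i)) differentiable at y"
      by (rule bounded_linear_imp_differentiable[OF bounded_linear_coordinate])
    moreover have "?w1 differentiable at y"
      using has_derivative_soft_radial[OF e wave1_derivative] by (auto simp: differentiable_def)
    moreover have "partial i (\<lambda>y::real^3. complex_of_real (y $ i)) y = 1"
      by (subst partial_eq_derivative[OF bounded_linear_imp_has_derivative[OF bounded_linear_coordinate]])
        (simp add: axis_def)
    ultimately show "partial i (partial i ?w0) y = of_real (y $ i) ^ 2 * ?w2 y + ?w1 y"
      unfolding w0' by (subst partial_mult)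
        (simp_all add: partial_soft_radial[OF e wave1_derivative] power2_eq_square)
  qed
  have loc: "locally_integrable ?w0" "locally_integrable (partial i (partial i ?w0))" for i
    unfolding w0'' by (intro locally_integrable_continuous continuous_intros w)+
  have "conv ?w0 (\<lambda>q. laplacian f q + of_real (k\<^sup>2) * f q) p
      = (\<Sum>i\<in>UNIV. conv ?w0 (partial i (partial i f)) p) + of_real (k\<^sup>2) * conv ?w0 f p"
  proof -
    have "bounded {q. laplacian f q \<noteq> 0}"
    proof (rule bounded_subset)
      show "bounded (\<Union>i. {q. partial i (partial i f) q \<noteq> 0})"
        using supp'' by auto
      show "{q. laplacian f q \<noteq> 0} \<subseteq> (\<Union>i. {q. partial i (partial i f) q \<noteq> 0})"
        unfolding laplacian_def using sum.not_neutral_contains_not_neutral by fastforce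
    qed
    moreover have "continuous_on UNIV (laplacian f)"
      unfolding laplacian_def[abs_def] by (intro continuous_intros cont)
    moreover have "bounded {q. of_real (k\<^sup>2) * f q \<noteq> 0}"
      by (rule bounded_subset[OF f(2)]) auto
    ultimately have "conv ?w0 (\<lambda>q. laplacian f q + of_real (k\<^sup>2) * f q) p
        = conv ?w0 (laplacian f) p + conv ?w0 (\<lambda>q. of_real (k\<^sup>2) * f q) p"
      by (intro conv_add loc continuous_intros cont)
    then show ?thesis
      unfolding laplacian_def[abs_def] by (simp only: conv_sum[OF loc(1) cont(2) supp''] conv_cmult)
  qed
  also have "(\<Sum>i\<in>UNIV. conv ?w0 (partial i (partial i f)) p)
      = (\<Sum>i\<in>UNIV. conv (partial i (partial i ?w0)) f p)"
  proof (rule sum.cong[OF refl])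
    fix i
    show "conv ?w0 (partial i (partial i f)) p = conv (partial i (partial i ?w0)) f p"
      using conv_partial_swap[OF C1(1) f1(2) supp', of i i p] conv_partial_swap[OF C1(2) f1(1) f(2), of i i p]
      by (simp only: w0')
  qed
  also have "\<dots> + of_real (k\<^sup>2) * conv ?w0 f p =
     (\<integral>y. ((\<Sum>i\<in>UNIV. partial i (partial i ?w0) y) + of_real (k\<^sup>2) * ?w0 y) * f (p - y) \<partial>lborel)"
  proof -
    have i: "has_bochner_integral lborel (\<lambda>y. g y * f (p - y)) (conv g f p)" if "locally_integrable g" for g
      using integrable_conv[OF that cont(1) f(2)] by (simp add: has_bochner_integral_iff conv_def)
    have "has_bochner_integral lborel (\<lambda>y. (\<Sum>i\<in>UNIV. partial i (partial i ?w0) y * f (p - y))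
        + of_real (k\<^sup>2) * (?w0 y * f (p - y)))
       ((\<Sum>i\<in>UNIV. conv (partial i (partial i ?w0)) f p) + of_real (k\<^sup>2) * conv ?w0 f p)"
      by (intro has_bochner_integral_add has_bochner_integral_sum has_bochner_integral_mult_right i loc)
    from has_bochner_integral_integral_eq[OF this, symmetric] show ?thesis
      by (simp add: distrib_right sum_distrib_right mult.assoc)
  qed
  also have "\<dots> = - (of_real (e\<^sup>2) * conv ?w2 f p)"
  proof -
    have "(\<Sum>i\<in>UNIV. partial i (partial i ?w0) y) + of_real (k\<^sup>2) * ?w0 y = - (of_real (e\<^sup>2) * ?w2 y)" for y :: "real^3"
    proof -
      have "(norm y)\<^sup>2 = (\<Sum>i\<in>UNIV. (y $ i)\<^sup>2)"
        by (simp add: norm_vec_def L2_set_def sum_nonneg)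
      then have "(\<Sum>i\<in>UNIV. partial i (partial i ?w0) y) = of_real ((norm y)\<^sup>2) * ?w2 y + 3 * ?w1 y"
        unfolding w0'' by (simp add: sum_3 algebra_simps)
      \<comment> \<open>The recurrence needs the square of the soft norm in front of
        \<open>wave2\<close>; the surplus e^2 is the whole defect.\<close>
      also have "(norm y)\<^sup>2 = (soft_norm e y)\<^sup>2 - e\<^sup>2"
        by (simp add: power2_soft_norm)
      also have "of_real \<dots> * ?w2 y + 3 * ?w1 y
          = (3 * ?w1 y + of_real ((soft_norm e y)\<^sup>2) * ?w2 y) - of_real (e\<^sup>2) * ?w2 y"
        by (simp add: left_diff_distrib)
      finally show ?thesis
        unfolding wave_recurrence[OF soft_norm_pos[OF e, of y], of k] by simp
    qed
    then have "(\<integral>y. ((\<Sum>i\<in>UNIV. partial i (partial i ?w0) y) + of_real (k\<^sup>2) * ?w0 y) * f (p - y) \<partial>lborel)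
        = (\<integral>y. (- of_real (e\<^sup>2)) * (?w2 y * f (p - y)) \<partial>lborel)"
      by (intro Bochner_Integration.integral_cong) simp_all
    then show ?thesis
      unfolding integral_mult_right_zero conv_def by simp
  qed
  finally show ?thesis .
qed

section \<open>The Green's function as the limit of the regularised kernels\<close>

lemma locally_integrable_green: "locally_integrable (green k)"
  unfolding locally_integrable_def
proof (intro conjI allI)
  show meas: "green k \<in> borel_measurable borel"
    unfolding green_def[abs_def] by measurable
  fix R :: real
  \<comment> \<open>The kernel has modulus 1 / (4 pi |z|), and in the ball of radius
    \<open>R\<close> the soft norm of z is at most that of \<open>R\<close>.\<close>
  define C where "C = soft_norm 1 R ^ 3 / (4 * pi)"
  show "set_integrable lborel (cball 0 R) (green k)"
    unfolding set_integrable_def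
  proof (rule Bochner_Integration.integrable_bound)
    show "integrable lborel (\<lambda>z::real^3. C * (1 / (norm z * soft_norm 1 z ^ 3)))"
      by (intro integrable_mult_right integrable_radial_dominant)
    show "(\<lambda>x. indicator (cball 0 R) x *\<^sub>R green k x) \<in> borel_measurable lborel"
      using meas by (intro borel_measurable_scaleR borel_measurable_indicator) simp_all
    have "norm (indicator (cball 0 R) z *\<^sub>R green k z) \<le> norm (C * (1 / (norm z * soft_norm 1 z ^ 3)))"
      for z :: "real^3"
    proof (cases "norm z \<le> R \<and> z \<noteq> 0")
      case True
      have "soft_norm 1 z \<le> soft_norm 1 R"
        unfolding soft_norm_def using True by (intro real_sqrt_le_mono add_left_mono power_mono) auto
      then have "soft_norm 1 z ^ 3 \<le> soft_norm 1 R ^ 3"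
        using soft_norm_pos[of 1 z] by (intro power_mono) auto
      then show ?thesis
        using True soft_norm_pos[of 1 z] soft_norm_pos[of 1 R]
        by (simp add: green_def norm_divide norm_mult C_def field_simps)
    qed (auto simp: green_def)
    then show "AE z in lborel. norm (indicator (cball 0 R) z *\<^sub>R green k z)
        \<le> norm (C * (1 / (norm z * soft_norm 1 z ^ 3)))"
      by simp
  qed
qed

text \<open>Since k is real, the regularised wave has modulus 1 / \<open>soft_norm e y\<close>, at
  most 1 / |y|. The modulus of the limit integrand is thus itself the dominating function.\<close>

lemma tendsto_conv_regularised_wave:
  fixes f :: "real^3 \<Rightarrow> complex"
  assumes f: "continuous_on UNIV f" "bounded {q. f q \<noteq> 0}"
    and e: "e \<longlonglongrightarrow> 0" "\<And>n. 0 < e n"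
  shows "(\<lambda>n. conv (\<lambda>y. wave0 k (soft_norm (e n) y)) f p) \<longlonglongrightarrow> - (4 * of_real pi * conv (green k) f p)"
proof -
  have "(\<lambda>n. \<integral>y. wave0 k (soft_norm (e n) y) * f (p - y) \<partial>lborel) \<longlonglongrightarrow>
      (\<integral>y. - (4 * of_real pi * (green k y * f (p - y))) \<partial>lborel)"
  proof (rule integral_dominated_convergence)
    show int: "integrable lborel (\<lambda>y. norm (- (4 * of_real pi * (green k y * f (p - y)))))"
      by (intro integrable_norm integrable_minus integrable_mult_right integrable_conv
          locally_integrable_green f)
    show "(\<lambda>y. - (4 * of_real pi * (green k y * f (p - y)))) \<in> borel_measurable lborel"
      using integrable_conv[OF locally_integrable_green f, of k p] by auto
    show "(\<lambda>y. wave0 k (soft_norm (e n) y) * f (p - y)) \<in> borel_measurable lborel" for n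
      using continuous_on_mult[OF continuous_on_wave_soft_norm(1)[OF e(2)[of n]] continuous_on_reflect[OF f(1)]]
      by (simp add: borel_measurable_continuous_onI)
    have nz: "AE y in lborel. (y::real^3) \<noteq> 0"
      by (rule AE_lborel_singleton)
    have w: "- (4 * of_real pi * green k y) = wave0 k (norm y)" for y
      by (simp add: green_def wave0_def field_simps)
    show "AE y in lborel. (\<lambda>n. wave0 k (soft_norm (e n) y) * f (p - y))
        \<longlonglongrightarrow> - (4 * of_real pi * (green k y * f (p - y)))"
      using nz
    proof eventually_elim
      case (elim y)
      have "(\<lambda>n. soft_norm (e n) y) \<longlonglongrightarrow> sqrt (0\<^sup>2 + (norm y)\<^sup>2)"
        unfolding soft_norm_def by (intro tendsto_intros e)
      then have "(\<lambda>n. soft_norm (e n) y) \<longlonglongrightarrow> norm y" by simp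
      moreover have "isCont (wave0 k) (norm y)"
        using continuous_on_wave(1)[of k] elim by (simp add: continuous_on_eq_continuous_at)
      ultimately have "(\<lambda>n. wave0 k (soft_norm (e n) y)) \<longlonglongrightarrow> wave0 k (norm y)"
        by (rule isCont_tendsto_compose[rotated])
      then have "(\<lambda>n. wave0 k (soft_norm (e n) y) * f (p - y)) \<longlonglongrightarrow> wave0 k (norm y) * f (p - y)"
        by (rule tendsto_mult_right)
      then show ?case
        by (simp flip: w add: mult.assoc)
    qed
    show "AE y in lborel. norm (wave0 k (soft_norm (e n) y) * f (p - y))
        \<le> norm (- (4 * of_real pi * (green k y * f (p - y))))" for n
      using nz
    proof eventually_elim
      case (elim y)
      have "norm (wave0 k (soft_norm (e n) y)) \<le> norm (wave0 k (norm y))"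
        using elim norm_le_soft_norm[of y "e n"] soft_norm_pos[OF e(2), of n y]
        by (simp add: wave0_def norm_mult norm_divide frac_le)
      then have "norm (wave0 k (soft_norm (e n) y) * f (p - y)) \<le> norm (wave0 k (norm y) * f (p - y))"
        by (simp add: norm_mult mult_right_mono)
      then show ?case
        by (simp flip: w add: mult.assoc)
    qed
  qed
  then show ?thesis
    by (simp add: conv_def)
qed

text \<open>The substitution y = e z turns the defect into a kernel on a fixed scale. Its leading
  term 3 / w^5 is free of \<open>e\<close> and has mass 4 pi, the other two carry powers of
  \<open>e\<close>, and f (p - e z) tends to f p.\<close>

lemma tendsto_conv_wave2:
  fixes f :: "real^3 \<Rightarrow> complex"
  assumes f: "continuous_on UNIV f" "bounded {q. f q \<noteq> 0}"
    and e: "e \<longlonglongrightarrow> 0" "\<And>n. 0 < e n" "\<And>n. e n \<le> 1"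
  shows "(\<lambda>n. of_real ((e n)\<^sup>2) * conv (\<lambda>y. wave2 k (soft_norm (e n) y)) f p) \<longlonglongrightarrow> 4 * of_real pi * f p"
proof -
  define F where "F n z = exp (\<i> * of_real (k * (e n * soft_norm 1 z))) *
    (3 / of_real (soft_norm 1 z) ^ 5 - 3 * \<i> * of_real (k * e n) / of_real (soft_norm 1 z) ^ 4
      - of_real (k * e n) ^ 2 / of_real (soft_norm 1 z) ^ 3) * f (p - e n *\<^sub>R z)" for n and z :: "real^3"
  have pos: "0 < soft_norm 1 z" for z :: "real^3"
    by (rule soft_norm_pos) simp
  have scaled: "of_real ((e n)\<^sup>2) * conv (\<lambda>y. wave2 k (soft_norm (e n) y)) f p = (\<integral>z. F n z \<partial>lborel)" for n
  proof -
    let ?c = "e n"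
    have "continuous_on UNIV (\<lambda>y. wave2 k (soft_norm ?c y) * f (p - y))"
      by (intro continuous_on_mult continuous_on_wave_soft_norm(3) continuous_on_reflect f(1) e(2))
    then have "conv (\<lambda>y. wave2 k (soft_norm ?c y)) f p
        = \<bar>?c\<bar> ^ DIM(real^3) *\<^sub>R (\<integral>z. wave2 k (soft_norm ?c (0 + ?c *\<^sub>R z)) * f (p - (0 + ?c *\<^sub>R z)) \<partial>lborel)"
      unfolding conv_def using e(2)[of n]
      by (intro integral_lborel_affine borel_measurable_continuous_onI) auto
    \<comment> \<open>The fifth power consists of the prefactor e^2 and the Jacobian e^3; it undoes
      the scaling of the leading term 3 / s^5 of \<open>wave2\<close>.\<close>
    then have "of_real (?c\<^sup>2) * conv (\<lambda>y. wave2 k (soft_norm ?c y)) f p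
        = (\<integral>z. of_real (?c ^ 5) * (wave2 k (soft_norm ?c (?c *\<^sub>R z)) * f (p - ?c *\<^sub>R z)) \<partial>lborel)"
      using e(2)[of n] by (simp add: scaleR_conv_of_real eval_nat_numeral mult_ac)
    also have "\<dots> = (\<integral>z. F n z \<partial>lborel)"
    proof (rule Bochner_Integration.integral_cong[OF refl])
      fix z :: "real^3"
      have "sqrt (?c\<^sup>2 + (norm (?c *\<^sub>R z))\<^sup>2) = sqrt (?c\<^sup>2 * (1 + (norm z)\<^sup>2))"
        by (simp add: power_mult_distrib distrib_left)
      then have "soft_norm ?c (?c *\<^sub>R z) = ?c * soft_norm 1 z"
        unfolding soft_norm_def using e(2)[of n] by (simp add: real_sqrt_mult)
      moreover have "of_real (?c ^ 5) * wave2 k (?c * s) = exp (\<i> * of_real (k * (?c * s))) *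
        (3 / of_real s ^ 5 - 3 * \<i> * of_real (k * ?c) / of_real s ^ 4 - of_real (k * ?c) ^ 2 / of_real s ^ 3)"
        if "0 < s" for s
        using that e(2)[of n] unfolding wave2_def
        by (simp add: divide_simps) (simp add: algebra_simps eval_nat_numeral)
      ultimately show "of_real (?c ^ 5) * (wave2 k (soft_norm ?c (?c *\<^sub>R z)) * f (p - ?c *\<^sub>R z)) = F n z"
        unfolding F_def using pos[of z] by (simp flip: mult.assoc)
    qed
    finally show ?thesis .
  qed
  obtain M where M: "\<And>q. norm (f q) \<le> M"
    using continuous_bounded_support_bound[OF f] by blast
  obtain R where R: "\<And>q. f q \<noteq> 0 \<Longrightarrow> norm q \<le> R"
    using f(2) unfolding bounded_iff by blast
  \<comment> \<open>One summand for each term of the kernel, all compared with w^-4. The third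
    contains the bound on e w that holds where f (p - e z) is nonzero.\<close>
  define C where "C = (3 + 3 * \<bar>k\<bar> + k\<^sup>2 * (1 + norm p + \<bar>R\<bar>)) * \<bar>M\<bar>"
  have "(\<lambda>n. \<integral>z. F n z \<partial>lborel) \<longlonglongrightarrow> (\<integral>z. 3 / of_real (soft_norm 1 z) ^ 5 * f p \<partial>(lborel :: (real^3) measure))"
  proof (rule integral_dominated_convergence)
    show "integrable lborel (\<lambda>z::real^3. C * (1 / (norm z * soft_norm 1 z ^ 3)))"
      by (intro integrable_mult_right integrable_radial_dominant)
    have "continuous_on UNIV (\<lambda>z. f (p - e n *\<^sub>R z))" for n
      by (rule continuous_on_compose2[OF f(1)]) (auto intro!: continuous_intros)
    then have "continuous_on UNIV (F n)" for n
      unfolding F_def using pos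
      by (intro continuous_intros) (auto simp: less_imp_neq[symmetric])
    then show "F n \<in> borel_measurable lborel" for n
      by (simp add: borel_measurable_continuous_onI)
    have "continuous_on UNIV (\<lambda>z::real^3. 3 / of_real (soft_norm 1 z) ^ 5 * f p)"
      using pos by (intro continuous_intros) (auto simp: less_imp_neq[symmetric])
    then show "(\<lambda>z::real^3. 3 / of_real (soft_norm 1 z) ^ 5 * f p) \<in> borel_measurable lborel"
      by (simp add: borel_measurable_continuous_onI)
    show "AE z in lborel. (\<lambda>n. F n z) \<longlonglongrightarrow> 3 / of_real (soft_norm 1 z) ^ 5 * f p"
    proof (rule AE_I2)
      fix z :: "real^3"
      have "(\<lambda>n. p - e n *\<^sub>R z) \<longlonglongrightarrow> p - 0 *\<^sub>R z"
        by (intro tendsto_intros e)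
      then have "(\<lambda>n. p - e n *\<^sub>R z) \<longlonglongrightarrow> p" by simp
      moreover have "isCont f p"
        using f(1) by (simp add: continuous_on_eq_continuous_at)
      ultimately have "(\<lambda>n. f (p - e n *\<^sub>R z)) \<longlonglongrightarrow> f p"
        by (rule isCont_tendsto_compose[rotated])
      then have "(\<lambda>n. F n z) \<longlonglongrightarrow> exp (\<i> * of_real (k * (0 * soft_norm 1 z))) *
        (3 / of_real (soft_norm 1 z) ^ 5 - 3 * \<i> * of_real (k * 0) / of_real (soft_norm 1 z) ^ 4
          - of_real (k * 0) ^ 2 / of_real (soft_norm 1 z) ^ 3) * f p"
        unfolding F_def using pos[of z] by (intro tendsto_intros e) auto
      then show "(\<lambda>n. F n z) \<longlonglongrightarrow> 3 / of_real (soft_norm 1 z) ^ 5 * f p"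
        by simp
    qed
    show "AE z in lborel. norm (F n z) \<le> C * (1 / (norm z * soft_norm 1 z ^ 3))" for n
      using AE_lborel_singleton[of 0]
    proof eventually_elim
      case (elim z)
      let ?s = "soft_norm 1 z"
      have s: "1 \<le> ?s" "norm z \<le> ?s" by (rule soft_norm_ge_1 norm_le_soft_norm)+
      show ?case
      proof (cases "f (p - e n *\<^sub>R z) = 0")
        case True
        have "0 \<le> C" by (simp add: C_def)
        then show ?thesis using True s by (simp add: F_def)
      next
        case False
        then have "norm (p - e n *\<^sub>R z) \<le> R" by (rule R)
        then have "e n * norm z \<le> norm p + R"
          using norm_triangle_ineq2[of "e n *\<^sub>R z" p] e(2)[of n] norm_minus_commute[of p "e n *\<^sub>R z"] by simp
        moreover have "e n * ?s \<le> e n * (1 + norm z)"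
          using soft_norm_le[of 1 z] e(2)[of n] by (intro mult_left_mono) auto
        ultimately have es: "e n * ?s \<le> 1 + norm p + \<bar>R\<bar>"
          using e(3)[of n] by (simp add: distrib_left)
        have "norm (F n z) \<le> (3 / ?s ^ 5 + 3 * \<bar>k\<bar> * e n / ?s ^ 4 + (k * e n)\<^sup>2 / ?s ^ 3) * norm (f (p - e n *\<^sub>R z))"
        proof -
          have "norm (3 / of_real ?s ^ 5 - 3 * \<i> * of_real (k * e n) / of_real ?s ^ 4
              - of_real (k * e n) ^ 2 / of_real ?s ^ 3 :: complex)
            \<le> norm (3 / of_real ?s ^ 5 :: complex) + norm (3 * \<i> * of_real (k * e n) / of_real ?s ^ 4 :: complex)
              + norm (of_real (k * e n) ^ 2 / of_real ?s ^ 3 :: complex)"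
            by (intro norm_triangle_le_diff add_mono order_refl)
          also have "\<dots> = 3 / ?s ^ 5 + 3 * \<bar>k\<bar> * e n / ?s ^ 4 + (k * e n)\<^sup>2 / ?s ^ 3"
            using s e(2)[of n] by (simp add: norm_divide norm_mult norm_power abs_mult power_mult_distrib)
          finally show ?thesis
            unfolding F_def by (simp add: norm_mult mult_right_mono)
        qed
        also have "\<dots> \<le> ((3 + 3 * \<bar>k\<bar> + k\<^sup>2 * (1 + norm p + \<bar>R\<bar>)) / ?s ^ 4) * \<bar>M\<bar>"
        proof (rule mult_mono)
          have "3 / ?s ^ 5 \<le> 3 / ?s ^ 4"
            using s by (intro divide_left_mono power_increasing mult_pos_pos) auto
          moreover have "3 * \<bar>k\<bar> * e n / ?s ^ 4 \<le> 3 * \<bar>k\<bar> / ?s ^ 4"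
            using s e(2,3)[of n] by (intro divide_right_mono mult_left_le) auto
          \<comment> \<open>By itself w^-3 is not integrable at infinity. One of the two factors
            \<open>e\<close> is traded for a further power of 1 / w, since e w is bounded on the
            support of \<open>f\<close>.\<close>
          moreover have "(k * e n)\<^sup>2 / ?s ^ 3 \<le> k\<^sup>2 * (1 + norm p + \<bar>R\<bar>) / ?s ^ 4"
          proof -
            have "(k * e n)\<^sup>2 / ?s ^ 3 = k\<^sup>2 * (e n * (e n * ?s)) / ?s ^ 4"
              using s by (simp add: divide_simps eval_nat_numeral)
            also have "e n * (e n * ?s) \<le> 1 * (1 + norm p + \<bar>R\<bar>)"
              using e(2,3)[of n] es s by (intro mult_mono) auto
            finally show ?thesis using s by (simp add: divide_right_mono mult_left_mono)
          qed
          ultimately show "3 / ?s ^ 5 + 3 * \<bar>k\<bar> * e n / ?s ^ 4 + (k * e n)\<^sup>2 / ?s ^ 3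
              \<le> (3 + 3 * \<bar>k\<bar> + k\<^sup>2 * (1 + norm p + \<bar>R\<bar>)) / ?s ^ 4"
            by (simp add: add_divide_distrib)
        qed (use M[of "p - e n *\<^sub>R z"] s in auto)
        also have "\<dots> = C * (1 / ?s ^ 4)" by (simp add: C_def)
        also have "\<dots> \<le> C * (1 / (norm z * ?s ^ 3))"
        proof (rule mult_left_mono)
          have "norm z * ?s ^ 3 \<le> ?s ^ 4"
            using s by (simp add: eval_nat_numeral mult_right_mono)
          then show "1 / ?s ^ 4 \<le> 1 / (norm z * ?s ^ 3)"
            using elim s by (intro divide_left_mono) auto
          show "0 \<le> C" by (simp add: C_def)
        qed
        finally show ?thesis .
      qed
    qed
  qed
  also have "(\<integral>z. 3 / of_real (soft_norm 1 z) ^ 5 * f p \<partial>(lborel :: (real^3) measure))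
      = (\<integral>z. 3 * f p * of_real (1 / soft_norm 1 z ^ 5) \<partial>(lborel :: (real^3) measure))"
    by (simp add: mult_ac)
  also have "\<dots> = 4 * of_real pi * f p"
    by (simp only: integral_mult_right_zero integral_complex_of_real integral_soft_norm_power5) simp
  finally show ?thesis by (simp only: scaled)
qed

text \<open>The same sequence of convolutions has two limits: before the derivatives are moved onto
  the kernel it tends to the convolution with \<open>green\<close>, afterwards to the value of
  \<open>f\<close>.\<close>

lemma conv_green_helmholtz:
  assumes f: "Ck_on 2 UNIV f" "bounded {q. f q \<noteq> 0}"
  shows "conv (green k) (\<lambda>q. laplacian f q + of_real (k\<^sup>2) * f q) p = f p"
proof -
  define e where "e n = 1 / real (Suc n)" for n
  have e: "e \<longlonglongrightarrow> 0" "\<And>n. 0 < e n" "\<And>n. e n \<le> 1"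
    using LIMSEQ_inverse_real_of_nat by (simp_all add: e_def[abs_def] inverse_eq_divide)
  let ?g = "\<lambda>q. laplacian f q + of_real (k\<^sup>2) * f q"
  have f1: "continuous_on UNIV f" "continuous_on UNIV (partial i (partial i f))" for i
    using f(1) by (auto simp: numeral_2_eq_2 intro: differentiable_imp_continuous_on)
  have g: "continuous_on UNIV ?g"
    unfolding laplacian_def by (intro continuous_intros f1)
  have "?g q = 0" if "f q = 0" "\<And>i. partial i (partial i f) q = 0" for q
    using that by (simp add: laplacian_def)
  then have "{q. ?g q \<noteq> 0} \<subseteq> {q. f q \<noteq> 0} \<union> (\<Union>i. {q. partial i (partial i f) q \<noteq> 0})"
    by blast
  moreover have "bounded ({q. f q \<noteq> 0} \<union> (\<Union>i. {q. partial i (partial i f) q \<noteq> 0}))"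
    using f(2) bounded_support_partial[OF bounded_support_partial[OF f(2)]] by auto
  ultimately have "bounded {q. ?g q \<noteq> 0}"
    by (rule bounded_subset[rotated])
  from tendsto_conv_regularised_wave[OF g this e(1,2), of k p]
  have "(\<lambda>n. - (of_real ((e n)\<^sup>2) * conv (\<lambda>y. wave2 k (soft_norm (e n) y)) f p))
      \<longlonglongrightarrow> - (4 * of_real pi * conv (green k) ?g p)"
    by (simp only: conv_regularised_wave[OF e(2) f])
  moreover have "(\<lambda>n. - (of_real ((e n)\<^sup>2) * conv (\<lambda>y. wave2 k (soft_norm (e n) y)) f p))
      \<longlonglongrightarrow> - (4 * of_real pi * f p)"
    by (intro tendsto_minus tendsto_conv_wave2 f1 f(2) e)
  ultimately have "- (4 * of_real pi * conv (green k) ?g p) = - (4 * of_real pi * f p)"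
    by (rule LIMSEQ_unique)
  then show ?thesis by simp
qed

section \<open>Vector fields and the vector potential\<close>

lemma curl_nth:
  "curl F p $ 1 = partial 2 (\<lambda>q. F q $ 3) p - partial 3 (\<lambda>q. F q $ 2) p"
  "curl F p $ 2 = partial 3 (\<lambda>q. F q $ 1) p - partial 1 (\<lambda>q. F q $ 3) p"
  "curl F p $ 3 = partial 1 (\<lambda>q. F q $ 2) p - partial 2 (\<lambda>q. F q $ 1) p"
  by (simp_all add: curl_def)

lemma curl_cong:
  assumes "open S" "p \<in> S" "\<And>q. q \<in> S \<Longrightarrow> F q = G q"
  shows "curl F p = curl G p"
proof -
  have "partial i (\<lambda>q. F q $ j) p = partial i (\<lambda>q. G q $ j) p" for i j
    by (rule partial_cong[OF assms(1,2)]) (simp add: assms(3))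
  then show ?thesis by (simp add: curl_def)
qed

lemma curl_add:
  assumes "\<And>i. (\<lambda>q. F q $ i) differentiable at p" "\<And>i. (\<lambda>q. G q $ i) differentiable at p"
  shows "curl (\<lambda>q. F q + G q) p = curl F p + curl G p"
  by (simp add: vec_eq_iff forall_3 curl_nth partial_add assms)

lemma curl_diff:
  assumes "\<And>i. (\<lambda>q. F q $ i) differentiable at p" "\<And>i. (\<lambda>q. G q $ i) differentiable at p"
  shows "curl (\<lambda>q. F q - G q) p = curl F p - curl G p"
  by (simp add: vec_eq_iff forall_3 curl_nth partial_diff assms)

lemma curl_cmult:
  assumes "\<And>i. (\<lambda>q. F q $ i) differentiable at p"
  shows "curl (\<lambda>q. c *s F q) p = c *s curl F p"
proof -
  have "partial i (\<lambda>q. c * F q $ j) p = c * partial i (\<lambda>q. F q $ j) p" for i j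
    by (rule partial_bounded_linear[OF bounded_linear_mult_right assms])
  then show ?thesis
    by (simp add: vec_eq_iff forall_3 curl_nth right_diff_distrib)
qed

lemma curl_grad:
  assumes "open S" "p \<in> S" "Ck_on 2 S f"
  shows "curl (grad f) p = 0"
proof -
  have "partial i (\<lambda>q. grad f q $ j) p = partial j (\<lambda>q. grad f q $ i) p" for i j
    using partial_commute[OF assms, of i j] by (simp add: grad_def)
  then show ?thesis
    by (simp add: vec_eq_iff forall_3 curl_nth)
qed

text \<open>Regularity of vector fields is required of the components, which is how they enter
  \<open>curl\<close> and \<open>divergence\<close>.\<close>

definition Ck_field :: "nat \<Rightarrow> (real^3) set \<Rightarrow> (real^3 \<Rightarrow> complex^3) \<Rightarrow> bool" where
  "Ck_field n S F \<longleftrightarrow> (\<forall>i. Ck_on n S (\<lambda>q. F q $ i))"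

lemma Ck_field_of_Ck_on:
  assumes "open S" "Ck_on n S F"
  shows "Ck_field n S F"
  unfolding Ck_field_def by (intro allI Ck_on_bounded_linear[OF bounded_linear_vec_nth assms])

lemma Ck_field_differentiable:
  assumes "Ck_field (Suc n) S F" "open S" "p \<in> S"
  shows "(\<lambda>q. F q $ i) differentiable at p"
  using assms by (auto simp: Ck_field_def dest: differentiable_on_openD)

lemma Ck_field_curl:
  assumes "open S" "Ck_field (Suc n) S F"
  shows "Ck_field n S (curl F)"
  unfolding Ck_field_def
proof
  fix i
  have "Ck_on n S (partial a (\<lambda>q. F q $ b))" for a b
    using assms(2) by (simp add: Ck_field_def)
  then have "Ck_on n S (\<lambda>q. partial a (\<lambda>q. F q $ b) q - partial a' (\<lambda>q. F q $ b') q)" for a b a' b'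
    by (intro Ck_on_diff assms(1)) auto
  then show "Ck_on n S (\<lambda>q. curl F q $ i)"
    using exhaust_3[of i] by (auto simp: curl_nth)
qed

lemma Ck_on_divergence:
  assumes "open S" "Ck_field (Suc n) S F"
  shows "Ck_on n S (divergence F)"
  unfolding divergence_def[abs_def] using assms by (intro Ck_on_sum) (auto simp: Ck_field_def)

lemma divergence_curl:
  assumes "open S" "p \<in> S" "Ck_field 2 S F"
  shows "divergence (curl F) p = 0"
proof -
  have F: "Ck_on 2 S (\<lambda>q. F q $ j)" for j
    using assms(3) by (simp add: Ck_field_def)
  have "partial i (\<lambda>q. F q $ j) differentiable at p" for i j
    using F[of j] assms(1,2) by (auto simp: numeral_2_eq_2 dest: differentiable_on_openD)
  then show ?thesis
    using partial_commute[OF assms(1,2) F[of 3], of 1 2] partial_commute[OF assms(1,2) F[of 2], of 1 3]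
      partial_commute[OF assms(1,2) F[of 1], of 2 3]
    by (simp add: divergence_def sum_3 curl_nth partial_diff)
qed

lemma curl_curl_nth:
  assumes "open S" "p \<in> S" "Ck_field 2 S F"
  shows "curl (curl F) p $ i = partial i (divergence F) p - laplacian (\<lambda>q. F q $ i) p"
proof -
  have F: "Ck_on 2 S (\<lambda>q. F q $ j)" for j
    using assms(3) by (simp add: Ck_field_def)
  have diff: "partial a (\<lambda>q. F q $ j) differentiable at p" for a j
    using F[of j] assms(1,2) by (auto simp: numeral_2_eq_2 dest: differentiable_on_openD)
  have "partial i (divergence F) p = (\<Sum>j\<in>UNIV. partial i (partial j (\<lambda>q. F q $ j)) p)"
    unfolding divergence_def[abs_def] by (rule partial_sum) (use diff in auto)
  also have "\<dots> = (\<Sum>j\<in>UNIV. partial j (partial i (\<lambda>q. F q $ j)) p)"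
    by (intro sum.cong refl partial_commute[OF assms(1,2) F])
  finally have div: "partial i (divergence F) p = (\<Sum>j\<in>UNIV. partial j (partial i (\<lambda>q. F q $ j)) p)" .
  show ?thesis
    unfolding div laplacian_def using exhaust_3[of i]
    by (auto simp: sum_3 curl_nth partial_diff diff)
qed

section \<open>Convolution of vector fields\<close>

definition conv_field :: "(real^3 \<Rightarrow> complex) \<Rightarrow> (real^3 \<Rightarrow> complex^3) \<Rightarrow> real^3 \<Rightarrow> complex^3" where
  "conv_field g F p = (\<chi> i. conv g (\<lambda>q. F q $ i) p)"

lemma bounded_support_component:
  fixes F :: "real^3 \<Rightarrow> complex^3"
  assumes "bounded {q. F q \<noteq> 0}"
  shows "bounded {q. F q $ i \<noteq> 0}"
  by (rule bounded_subset[OF assms]) auto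

lemma bounded_support_curl:
  assumes "bounded {q. F q \<noteq> 0}"
  shows "bounded {q. curl F q \<noteq> 0}"
proof (rule bounded_subset)
  show "bounded (\<Union>i. \<Union>j. {q. partial i (\<lambda>q. F q $ j) q \<noteq> 0})"
    by (intro bounded_UN finite ballI bounded_support_partial bounded_support_component assms)
  show "{q. curl F q \<noteq> 0} \<subseteq> (\<Union>i. \<Union>j. {q. partial i (\<lambda>q. F q $ j) q \<noteq> 0})"
  proof (rule subsetI, rule ccontr)
    fix q assume "q \<in> {q. curl F q \<noteq> 0}" "q \<notin> (\<Union>i. \<Union>j. {q. partial i (\<lambda>q. F q $ j) q \<noteq> 0})"
    then show False by (simp add: vec_eq_iff forall_3 curl_nth)
  qed
qed

lemma bounded_support_divergence:
  assumes "bounded {q. F q \<noteq> 0}"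
  shows "bounded {q. divergence F q \<noteq> 0}"
proof (rule bounded_subset)
  show "bounded (\<Union>i. \<Union>j. {q. partial i (\<lambda>q. F q $ j) q \<noteq> 0})"
    by (intro bounded_UN finite ballI bounded_support_partial bounded_support_component assms)
  show "{q. divergence F q \<noteq> 0} \<subseteq> (\<Union>i. \<Union>j. {q. partial i (\<lambda>q. F q $ j) q \<noteq> 0})"
  proof (rule subsetI, rule ccontr)
    fix q assume "q \<in> {q. divergence F q \<noteq> 0}" "q \<notin> (\<Union>i. \<Union>j. {q. partial i (\<lambda>q. F q $ j) q \<noteq> 0})"
    then show False by (simp add: divergence_def)
  qed
qed

context
  fixes g :: "real^3 \<Rightarrow> complex" and F :: "real^3 \<Rightarrow> complex^3"
  assumes g: "locally_integrable g" and F: "Ck_field 1 UNIV F" "bounded {q. F q \<noteq> 0}"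
begin

lemma partial_conv_field: "partial i (\<lambda>q. conv_field g F q $ j) = conv g (partial i (\<lambda>q. F q $ j))"
proof -
  have "Ck_on 1 UNIV (\<lambda>q. F q $ j)"
    using F(1) by (simp only: Ck_field_def)
  from partial_conv[OF g this bounded_support_component[OF F(2)]]
  show ?thesis by (simp add: conv_field_def)
qed

lemma continuous_on_partial_component: "continuous_on UNIV (partial i (\<lambda>q. F q $ j))"
  using F(1) by (auto simp: Ck_field_def)

lemma curl_conv_field: "curl (conv_field g F) = conv_field g (curl F)"
proof
  fix p
  note c = continuous_on_partial_component and b = bounded_support_partial[OF bounded_support_component[OF F(2)]]
  show "curl (conv_field g F) p = conv_field g (curl F) p"
    unfolding vec_eq_iff forall_3 curl_nth partial_conv_field
    by (simp add: conv_field_def curl_nth conv_diff[OF g c b c b])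
qed

lemma divergence_conv_field: "divergence (conv_field g F) = conv g (divergence F)"
proof
  fix p
  show "divergence (conv_field g F) p = conv g (divergence F) p"
    unfolding divergence_def[abs_def] partial_conv_field
    by (rule conv_sum[symmetric, OF g])
      (use continuous_on_partial_component bounded_support_partial[OF bounded_support_component[OF F(2)]] in auto)
qed

lemma conv_field_differentiable: "(\<lambda>q. conv_field g F q $ i) differentiable at p"
proof -
  have "Ck_on 1 UNIV (\<lambda>q. F q $ i)"
    using F(1) by (simp only: Ck_field_def)
  from conv_differentiable[OF g this bounded_support_component[OF F(2)]]
  show ?thesis by (simp add: conv_field_def)
qed

end

lemma Ck_field_conv:
  assumes "locally_integrable g" "Ck_field (Suc n) UNIV F" "bounded {q. F q \<noteq> 0}"
  shows "Ck_field n UNIV (conv_field g F)"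
  unfolding Ck_field_def conv_field_def
  using assms Ck_on_conv[OF assms(1)] bounded_support_component[OF assms(3)]
  by (simp add: Ck_field_def)

lemma grad_conv:
  assumes "locally_integrable g" "Ck_on 1 UNIV f" "bounded {q. f q \<noteq> 0}"
  shows "grad (conv g f) = conv_field g (grad f)"
  by (rule ext) (simp add: vec_eq_iff grad_def conv_field_def partial_conv[OF assms])

lemma Ck_field_SucD: "Ck_field (Suc n) S F \<Longrightarrow> Ck_field n S F"
  unfolding Ck_field_def by (blast dest: Ck_on_SucD)

text \<open>The identity curl curl = grad div - Laplacian is applied to \<open>J\<close>, where two
  derivatives exist, and then convolved. The gradient term is moved back out to give grad div A; the
  Laplacian term is J - k^2 A by the weak Helmholtz equation.\<close>

lemma curl_curl_conv_green:
  fixes J A :: "real^3 \<Rightarrow> complex^3" and k :: real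
  assumes J: "Ck_field 2 UNIV J" "bounded {q. J q \<noteq> 0}"
  defines "A \<equiv> conv_field (green k) J"
  shows "curl (curl A) p = scattered_electric k A p - J p"
proof -
  note G = locally_integrable_green[of k]
  have J': "Ck_field (Suc 1) UNIV J"
    using J(1) by (simp add: numeral_2_eq_2)
  note J1 = Ck_field_SucD[OF J'] Ck_field_curl[OF open_UNIV J']
  note divJ = Ck_on_divergence[OF open_UNIV J']
  have J2: "Ck_on 2 UNIV (\<lambda>q. J q $ i)" for i
    using J(1) by (simp add: Ck_field_def)
  have cont: "continuous_on UNIV (\<lambda>q. J q $ i)" "continuous_on UNIV (partial a (partial a (\<lambda>q. J q $ i)))"
    "continuous_on UNIV (partial i (divergence J))" for i a
    using J2[of i] Ck_on_imp_continuous_on[OF J2] C1_onD[OF divJ] by (auto simp: numeral_2_eq_2)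
  note supp = bounded_support_component[OF J(2)]
  have supp_div: "bounded {q. partial i (divergence J) q \<noteq> 0}" for i
    by (intro bounded_support_partial bounded_support_divergence J(2))
  have lap: "continuous_on UNIV (laplacian (\<lambda>q. J q $ i))" "bounded {q. laplacian (\<lambda>q. J q $ i) q \<noteq> 0}" for i
  proof -
    show "continuous_on UNIV (laplacian (\<lambda>q. J q $ i))"
      unfolding laplacian_def[abs_def] by (intro continuous_intros cont)
    have "{q. laplacian (\<lambda>q. J q $ i) q \<noteq> 0} \<subseteq> (\<Union>a. {q. partial a (partial a (\<lambda>q. J q $ i)) q \<noteq> 0})"
    proof (rule subsetI, rule ccontr)
      fix q assume "q \<in> {q. laplacian (\<lambda>q. J q $ i) q \<noteq> 0}"
        "q \<notin> (\<Union>a. {q. partial a (partial a (\<lambda>q. J q $ i)) q \<noteq> 0})"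
      then show False by (simp add: laplacian_def)
    qed
    moreover have "bounded (\<Union>a. {q. partial a (partial a (\<lambda>q. J q $ i)) q \<noteq> 0})"
      by (intro bounded_UN finite ballI bounded_support_partial supp)
    ultimately show "bounded {q. laplacian (\<lambda>q. J q $ i) q \<noteq> 0}"
      by (rule bounded_subset[rotated])
  qed
  have "curl (curl A) p $ i = scattered_electric k A p $ i - J p $ i" for i
  proof -
    have "curl (curl A) p $ i = conv (green k) (\<lambda>q. curl (curl J) q $ i) p"
      unfolding A_def curl_conv_field[OF G J1(1) J(2)]
        curl_conv_field[OF G J1(2) bounded_support_curl[OF J(2)]]
      by (simp add: conv_field_def)
    also have "\<dots> = conv (green k) (partial i (divergence J)) p - conv (green k) (laplacian (\<lambda>q. J q $ i)) p"
      unfolding curl_curl_nth[OF open_UNIV UNIV_I J(1)]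
      by (rule conv_diff[OF G cont(3) supp_div lap])
    also have "conv (green k) (partial i (divergence J)) p = grad (divergence A) p $ i"
      unfolding A_def divergence_conv_field[OF G J1(1) J(2)]
        grad_conv[OF G divJ bounded_support_divergence[OF J(2)]]
      by (simp add: conv_field_def grad_def)
    also have "conv (green k) (laplacian (\<lambda>q. J q $ i)) p = J p $ i - of_real (k\<^sup>2) * A p $ i"
    proof -
      have "bounded {q. of_real (k\<^sup>2) * J q $ i \<noteq> 0}"
        by (rule bounded_subset[OF supp[of i]]) auto
      then have "J p $ i = conv (green k) (laplacian (\<lambda>q. J q $ i)) p + conv (green k) (\<lambda>q. of_real (k\<^sup>2) * J q $ i) p"
        unfolding conv_green_helmholtz[OF J2[of i] supp[of i], of k p, symmetric]
        by (intro conv_add G lap continuous_intros cont)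
      then show ?thesis
        by (simp only: conv_cmult A_def conv_field_def vec_lambda_beta) simp
    qed
    finally show ?thesis by (simp add: scattered_electric_def)
  qed
  then show ?thesis by (simp add: vec_eq_iff)
qed

lemma bounded_linear_axis: "bounded_linear (axis i :: 'a::euclidean_space \<Rightarrow> 'a^'n)"
  unfolding linear_conv_bounded_linear[symmetric]
  by (rule linearI) (simp_all add: vec_eq_iff axis_def)

text \<open>The vector-valued integral has to be shown to exist before it can be computed by
  components, so the integrand is reassembled from integrable components along the axes. Restriction
  to \<Omega> changes nothing where \<open>X\<close> vanishes, and the reflection q to p - q
  produces the form of \<open>conv\<close>.\<close>

lemma vector_potential_eq_conv:
  assumes "{q. X q \<noteq> 0} \<subseteq> \<Omega>"
    and J: "\<And>i. continuous_on UNIV (\<lambda>q. X q * E q $ i)" "bounded {q. X q \<noteq> 0}"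
  shows "vector_potential k \<Omega> X E = conv_field (green k) (\<lambda>q. X q *s E q)"
proof
  fix p
  let ?h = "\<lambda>q. (green k (p - q) * X q) *s E q"
  have supp: "bounded {q. X q * E q $ i \<noteq> 0}" for i
    by (rule bounded_subset[OF J(2)]) auto
  have int: "integrable lborel (\<lambda>y. green k y * (X (p - y) * E (p - y) $ i))" for i
    by (rule integrable_conv[OF locally_integrable_green J(1) supp])
  have hi: "has_bochner_integral lborel (\<lambda>q. ?h q $ i) (conv (green k) (\<lambda>q. X q * E q $ i) p)" for i
  proof -
    let ?f = "\<lambda>y. green k y * (X (p - y) * E (p - y) $ i)"
    have meas: "?f \<in> borel_measurable borel"
      using int[of i] by auto
    have "integrable lborel (\<lambda>q. ?f (p + (-1) *\<^sub>R q))"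
    proof -
      have "integrable (density (distr lborel borel (\<lambda>x. p + (-1) *\<^sub>R x)) (\<lambda>_. ennreal (\<bar>-1\<bar> ^ DIM(real^3)))) ?f"
        using int[of i] lborel_affine[of "-1" p] by simp
      then show ?thesis
        using meas by (simp add: density_1 integrable_distr_eq)
    qed
    moreover have "(\<integral>q. ?f (p - q) \<partial>lborel) = (\<integral>q. ?f q \<partial>lborel)"
      by (rule integral_lborel_reflect[OF meas])
    ultimately show ?thesis
      by (simp add: has_bochner_integral_iff conv_def mult.assoc)
  qed
  have "has_bochner_integral lborel (\<lambda>q. \<Sum>i\<in>UNIV. axis i (?h q $ i))
      (\<Sum>i\<in>UNIV. axis i (conv (green k) (\<lambda>q. X q * E q $ i) p))"
    by (intro has_bochner_integral_sum has_bochner_integral_bounded_linear[OF bounded_linear_axis hi])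
  moreover have "(\<lambda>q. \<Sum>i\<in>UNIV. axis i (?h q $ i)) = ?h"
    by (simp add: fun_eq_iff vec_eq_iff forall_3 sum_3 axis_def)
  moreover have "(\<Sum>i\<in>UNIV. axis i (conv (green k) (\<lambda>q. X q * E q $ i) p))
      = (\<chi> i. conv (green k) (\<lambda>q. X q * E q $ i) p)"
    by (simp add: vec_eq_iff forall_3 sum_3 axis_def)
  ultimately have "has_bochner_integral lborel ?h (\<chi> i. conv (green k) (\<lambda>q. X q * E q $ i) p)"
    by (simp only:)
  moreover have "indicator \<Omega> q *\<^sub>R ?h q = ?h q" for q
    using assms(1) by (cases "X q = 0") (auto simp: vec_eq_iff)
  ultimately show "vector_potential k \<Omega> X E p = conv_field (green k) (\<lambda>q. X q *s E q) p"
    unfolding vector_potential_def set_lebesgue_integral_def conv_field_def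
    by (simp add: has_bochner_integral_integral_eq)
qed

section \<open>Differential forms\<close>

text \<open>Through this formula both 3-forms of the theorem become dot products of vector fields,
  bilinear and without conjugation.\<close>

lemma volume_coeff_one_form_wedge_hodge:
  "volume_coeff (one_form F \<^bold>\<and> hodge (one_form G)) p = (\<Sum>i\<in>UNIV. F p $ i * G p $ i)"
proof -
  have "(\<Sum>I\<in>UNIV. one_form F p I * one_form G p I) = (\<Sum>I\<in>range (\<lambda>i. {i}). one_form F p I * one_form G p I)"
  proof (rule sum.mono_neutral_right)
    show "\<forall>I\<in>UNIV - range (\<lambda>i. {i}). one_form F p I * one_form G p I = 0"
      by (auto simp: one_form_def intro!: sum.neutral)
  qed auto
  also have "\<dots> = (\<Sum>i\<in>UNIV. F p $ i * G p $ i)"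
    by (subst sum.reindex) (auto simp: inj_on_def one_form_singleton)
  finally show ?thesis by (simp add: wedge_hodge)
qed

lemma one_form_add: "one_form F + one_form G = one_form (\<lambda>p. F p + G p)"
  by (auto simp: fun_eq_iff one_form_def sum.distrib[symmetric] intro!: sum.cong)

lemma one_form_diff: "one_form F - one_form G = one_form (\<lambda>p. F p - G p)"
  by (auto simp: fun_eq_iff one_form_def sum_subtractf[symmetric] intro!: sum.cong)

lemma form_scale_one_form: "c \<^bold>\<cdot> one_form F = one_form (\<lambda>p. c *s F p)"
  by (auto simp: fun_eq_iff one_form_def form_scale_def sum_distrib_left intro!: sum.cong)

lemma hodge_add: "hodge \<alpha> + hodge \<beta> = hodge (\<alpha> + \<beta>)"
  by (simp add: fun_eq_iff hodge_def distrib_left)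

lemma hodge_diff: "hodge \<alpha> - hodge \<beta> = hodge (\<alpha> - \<beta>)"
  by (simp add: fun_eq_iff hodge_def right_diff_distrib)

lemma form_scale_hodge: "c \<^bold>\<cdot> hodge \<alpha> = hodge (c \<^bold>\<cdot> \<alpha>)"
  by (simp add: fun_eq_iff hodge_def form_scale_def)

lemma ext_d_one_form: "ext_d (one_form F) = hodge (one_form (curl F))"
  by (simp add: hodge_hodge flip: hodge_ext_d_one_form)

lemma ext_d_hodge_one_form:
  assumes "\<And>p. divergence F p = 0" "\<And>i p. (\<lambda>q. F q $ i) differentiable at p"
  shows "ext_d (hodge (one_form F)) = 0"
proof (intro ext)
  fix p and K :: "3 set"
  have diffs: "UNIV - {1::3} = {2,3}" "UNIV - {2::3} = {1,3}" "UNIV - {3::3} = {1,2}"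
    using Compl_3 by (simp_all add: Compl_eq_Diff_UNIV)
  have small: "hodge (one_form F) q {} = 0" "hodge (one_form F) q {i} = 0" for q and i :: 3
    using exhaust_3[of i] by (auto simp: hodge_one_form)
  have pair: "K - {i} = {} \<or> (\<exists>j. K - {i} = {j})" if "K \<noteq> UNIV" "i \<in> K" for i
    using set3_cases[of K] that by auto
  show "ext_d (hodge (one_form F)) p K = 0 p K"
  proof (cases "K = UNIV")
    case True
    \<comment> \<open>The star of dy is dz \<and> dx, while the basis monomial for {1,3} is dx
      \<and> dz. This minus sign has to leave \<open>partial\<close> before the divergence
      appears.\<close>
    have "partial 2 (\<lambda>q. - F q $ 2) p = - partial 2 (\<lambda>q. F q $ 2) p"
      by (rule partial_bounded_linear[OF bounded_linear_minus[OF bounded_linear_ident] assms(2)])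
    then show ?thesis
      using assms(1)[of p]
      by (simp add: True ext_d_def sum_3 diffs hodge_one_form doubleton_eq_iff wsign_code divergence_def)
  next
    case False
    then have "(\<lambda>q. hodge (one_form F) q (K - {i})) = (\<lambda>q. 0)" if "i \<in> K" for i
      using pair[OF False that] by (elim disjE exE) (simp_all only: small)
    then show ?thesis
      by (simp add: ext_d_def)
  qed
qed

text \<open>The star of a divergence-free 1-form is closed, so only the second half of the Laplacian
  survives, and it is the curl of the curl with a plus sign. Hence \<open>form_laplacian\<close>
  minus \<kappa> is minus the Helmholtz operator on such forms.\<close>

lemma form_laplacian_hodge_one_form:
  assumes "\<And>p. divergence F p = 0" "\<And>i p. (\<lambda>q. F q $ i) differentiable at p"
  shows "form_laplacian (hodge (one_form F)) = hodge (one_form (curl (curl F)))"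
proof -
  have "dual_d 0 = 0"
    by (simp add: fun_eq_iff dual_d_def hodge_def ext_d_def)
  then show ?thesis
    unfolding form_laplacian_def ext_d_hodge_one_form[OF assms]
    by (simp add: dual_d_def hodge_hodge hodge_ext_d_one_form ext_d_one_form)
qed

section \<open>The formula for the contrast\<close>

lemma dot_curl_scaled:
  assumes "X differentiable at p" "\<And>i. (\<lambda>q. E q $ i) differentiable at p"
  shows "(\<Sum>i\<in>UNIV. E p $ i * curl (\<lambda>q. X q *s E q) p $ i) = X p * (\<Sum>i\<in>UNIV. E p $ i * curl E p $ i)"
  \<comment> \<open>The triple product with the repeated factor \<open>E\<close> cancels term by
    term; as nothing is conjugated, this holds for complex fields too.\<close>
  by (simp add: sum_3 curl_nth partial_mult assms algebra_simps)

text \<open>The factors \<open>s\<close> come from B = s curl A: written with curl A, the form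
  \<open>F\<close> contains no \<open>s\<close>, and the numerator and the denominator contain one
  common factor \<open>s\<close>. The minus sign before \<kappa> in the numerator belongs to the
  sign convention of \<open>form_laplacian\<close>.\<close>

theorem theorem1:
  fixes \<Omega> antenna :: "(real^3) set"
    and \<sigma> \<epsilon> :: "real^3 \<Rightarrow> real"
    and \<omega> \<epsilon>0 \<mu>0 c0 k :: real
    and \<gamma>0 :: complex
    and X :: "real^3 \<Rightarrow> complex"
    and Einc E A Esc Hsc B :: "real^3 \<Rightarrow> complex^3"
  assumes positivity: "\<omega> > 0" "\<epsilon>0 > 0" "\<mu>0 > 0" "c0 > 0"
    and speed_of_light: "\<epsilon>0 * \<mu>0 = 1 / c0\<^sup>2"
    and k: "k = \<omega> / c0"
    and \<gamma>0: "\<gamma>0 = vacuum_admittivity \<omega> \<epsilon>0"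
    and X: "X = contrast \<omega> \<epsilon>0 \<sigma> \<epsilon>"
    and domain: "open \<Omega>" "connected \<Omega>"
    and support: "closure {q. X q \<noteq> 0} \<subseteq> \<Omega>" "bounded {q. X q \<noteq> 0}"
    and antenna: "closed antenna" "\<Omega> \<inter> antenna = {}"
    and regularity: "Ck_on 2 UNIV X" "Ck_on 2 (- antenna) Einc" "Ck_on 2 \<Omega> E"
    and A: "A = vector_potential k \<Omega> X E"
    and Esc: "Esc = scattered_electric k A"
    and Hsc: "Hsc = scattered_magnetic \<gamma>0 A"
    and total_field: "\<And>p. p \<notin> antenna \<Longrightarrow> E p = Einc p + Esc p"
    and B: "B = (\<lambda>p. of_real \<mu>0 *s Hsc p)"
  shows "let s = of_real \<mu>0 * \<gamma>0;
             \<kappa> = of_real (k\<^sup>2);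
             E' = one_form Einc;
             B' = one_form B;
             F = E' + inverse s \<^bold>\<cdot> hodge (ext_d B');
             num = F \<^bold>\<and> (form_laplacian (hodge B') - \<kappa> \<^bold>\<cdot> hodge B');
             den = F \<^bold>\<and> (s \<^bold>\<cdot> ext_d E' + \<kappa> \<^bold>\<cdot> hodge B')
         in \<forall>p\<in>\<Omega>. volume_coeff den p \<noteq> 0 \<longrightarrow> X p = - (volume_coeff num p / volume_coeff den p)"
proof -
  define s where "s = of_real \<mu>0 * \<gamma>0"
  define \<kappa> :: complex where "\<kappa> = of_real (k\<^sup>2)"
  define J where "J = (\<lambda>q. X q *s E q)"
  have s: "s \<noteq> 0"
    using positivity by (simp add: s_def \<gamma>0 vacuum_admittivity_def)
  note G = locally_integrable_green[of k]

  have CE: "Ck_field 2 \<Omega> E" "Ck_field 2 \<Omega> Einc"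
    using regularity(3) Ck_on_subset[OF regularity(2), of \<Omega>] antenna(2)
    by (auto intro!: Ck_field_of_Ck_on domain(1))
  have J: "Ck_field 2 UNIV J"
    unfolding Ck_field_def
  proof
    fix i
    \<comment> \<open>Nothing is known about the regularity of \<open>E\<close> outside \<Omega>. On
      the complement of \<open>?K\<close>, which is open, the product is 0 whatever \<open>E\<close>
      is.\<close>
    let ?K = "closure {q. X q \<noteq> 0}"
    have "Ck_on 2 \<Omega> (\<lambda>q. X q * E q $ i)"
      using CE(1) Ck_on_subset[OF regularity(1)] domain(1)
      by (intro Ck_on_mult) (simp_all add: Ck_field_def)
    moreover have "Ck_on 2 (- ?K) (\<lambda>q. X q * E q $ i) \<longleftrightarrow> Ck_on 2 (- ?K) (\<lambda>q. 0 :: complex)"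
      using closure_subset[of "{q. X q \<noteq> 0}"] by (intro Ck_on_cong) auto
    moreover have "\<Omega> \<union> - ?K = UNIV"
      using support(1) by blast
    ultimately show "Ck_on 2 UNIV (\<lambda>q. J q $ i)"
      using Ck_on_Un_open[of \<Omega> "- ?K" 2 "\<lambda>q. X q * E q $ i"] domain(1)
      by (simp add: J_def open_Compl del: Ck_on.simps)
  qed
  have J_supp: "bounded {q. J q \<noteq> 0}"
    by (rule bounded_subset[OF support(2)]) (auto simp: J_def)
  have J': "Ck_field (Suc 1) UNIV J"
    using J by (simp add: numeral_2_eq_2)
  note J1 = Ck_field_SucD[OF J'] Ck_field_curl[OF open_UNIV J']

  have A_conv: "A = conv_field (green k) J"
    unfolding A J_def
  proof (rule vector_potential_eq_conv[OF _ _ support(2)])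
    show "{q. X q \<noteq> 0} \<subseteq> \<Omega>"
      using closure_subset support(1) by (rule subset_trans)
    show "continuous_on UNIV (\<lambda>q. X q * E q $ i)" for i
      using J Ck_on_imp_continuous_on[of 2 UNIV "\<lambda>q. X q * E q $ i"] by (simp add: Ck_field_def J_def)
  qed
  have A1: "Ck_field 1 UNIV A"
    unfolding A_conv by (rule Ck_field_conv[OF G J' J_supp])
  have curl_A: "curl A = conv_field (green k) (curl J)"
    unfolding A_conv by (rule curl_conv_field[OF G J1(1) J_supp])
  have curl_A_diff: "(\<lambda>q. curl A q $ i) differentiable at p" for i p
    unfolding curl_A by (rule conv_field_differentiable[OF G J1(2) bounded_support_curl[OF J_supp]])
  have B_eq: "B = (\<lambda>p. s *s curl A p)"
    by (simp add: B Hsc scattered_magnetic_def s_def vec_eq_iff fun_eq_iff)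
  have B_diff: "(\<lambda>q. B q $ i) differentiable at p" for i p
    unfolding B_eq using curl_A_diff[of i p] by simp
  have curl_B: "curl B p = s *s (Esc p - J p)" for p
  proof -
    have "curl B p = s *s curl (curl A) p"
      unfolding B_eq by (rule curl_cmult) (rule curl_A_diff)
    then show ?thesis
      unfolding Esc A_conv by (simp only: curl_curl_conv_green[OF J J_supp])
  qed
  have div_B: "divergence B p = 0" for p
  proof -
    have "divergence (curl A) p = conv (green k) (divergence (curl J)) p"
      unfolding curl_A divergence_conv_field[OF G J1(2) bounded_support_curl[OF J_supp]] ..
    also have "divergence (curl J) = (\<lambda>q. 0)"
      using divergence_curl[OF open_UNIV UNIV_I J] by blast
    finally have "divergence (curl A) p = 0" by simp
    moreover have "divergence B p = s * divergence (curl A) p"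
      unfolding B_eq divergence_def
      by (simp add: sum_distrib_left partial_bounded_linear[OF bounded_linear_mult_right curl_A_diff])
    ultimately show ?thesis by simp
  qed

  have main: "X p = - (volume_coeff num p / volume_coeff den p)"
    if p: "p \<in> \<Omega>" and nz: "volume_coeff den p \<noteq> 0"
      and num: "num = (one_form Einc + inverse s \<^bold>\<cdot> hodge (ext_d (one_form B))) \<^bold>\<and>
        (form_laplacian (hodge (one_form B)) - \<kappa> \<^bold>\<cdot> hodge (one_form B))"
      and den: "den = (one_form Einc + inverse s \<^bold>\<cdot> hodge (ext_d (one_form B))) \<^bold>\<and>
        (s \<^bold>\<cdot> ext_d (one_form Einc) + \<kappa> \<^bold>\<cdot> hodge (one_form B))" for p num den
  proof -
    define v where "v = divergence A"
    have diff: "(\<lambda>q. E q $ i) differentiable at p" "(\<lambda>q. Einc q $ i) differentiable at p"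
      "(\<lambda>q. A q $ i) differentiable at p" "(\<lambda>q. J q $ i) differentiable at p" for i
      using Ck_field_differentiable[of 1 \<Omega> E p i] Ck_field_differentiable[of 1 \<Omega> Einc p i] CE domain(1) p
        Ck_field_differentiable[of 0 UNIV A p i] Ck_field_differentiable[of 0 UNIV J p i] A1 J1(1)
      by (simp_all add: numeral_2_eq_2)
    have Esc_eq: "Esc q = E q - Einc q" if "q \<in> \<Omega>" for q
    proof -
      have "q \<notin> antenna" using that antenna(2) by blast
      then show ?thesis using total_field[of q] by simp
    qed
    have Esc_v: "Esc q = \<kappa> *s A q + grad v q" for q
      by (simp add: Esc scattered_electric_def \<kappa>_def v_def)
    have grad_v: "partial i v q = E q $ i - Einc q $ i - \<kappa> * A q $ i" if "q \<in> \<Omega>" for q i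
      using Esc_eq[OF that] Esc_v[of q] by (simp add: vec_eq_iff grad_def algebra_simps)
    have grad_v1: "Ck_on 1 \<Omega> (partial i v)" for i
    proof -
      have "Ck_on 1 \<Omega> (\<lambda>q. E q $ i - Einc q $ i - \<kappa> * A q $ i)"
      proof (intro Ck_on_diff Ck_on_cmult domain(1))
        have "Ck_field 1 \<Omega> E" "Ck_field 1 \<Omega> Einc"
          using CE Ck_field_SucD[of 1 \<Omega>] by (simp_all add: numeral_2_eq_2)
        then show "Ck_on 1 \<Omega> (\<lambda>q. E q $ i)" "Ck_on 1 \<Omega> (\<lambda>q. Einc q $ i)"
          by (simp_all only: Ck_field_def)
        show "Ck_on 1 \<Omega> (\<lambda>q. A q $ i)"
          by (rule Ck_on_subset[of 1 UNIV]) (use A1 in \<open>simp_all only: Ck_field_def subset_UNIV\<close>)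
      qed
      then show ?thesis
        by (subst Ck_on_cong[OF domain(1) grad_v])
    qed
    \<comment> \<open>As a convolution with the C^1 function \<open>divergence J\<close>,
      \<open>v\<close> is differentiable; the second order comes from \<open>grad_v1\<close>, hence
      from the regularity assumed of \<open>E\<close> and \<open>Einc\<close> in \<Omega>.\<close>
    have v2: "Ck_on 2 \<Omega> v"
    proof -
      have "v differentiable at q" for q
        unfolding v_def A_conv divergence_conv_field[OF G J1(1) J_supp]
        by (intro conv_differentiable G bounded_support_divergence J_supp Ck_on_divergence[OF open_UNIV J'])
      then show ?thesis
        using grad_v1 by (auto simp: numeral_2_eq_2 intro: differentiable_at_imp_differentiable_on)
    qed
    have Esc_parts: "(\<lambda>q. grad v q $ i) differentiable at p" "(\<lambda>q. (\<kappa> *s A q) $ i) differentiable at p" for i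
      using grad_v1[of i] diff(3)[of i] p domain(1) by (auto simp: grad_def dest: differentiable_on_openD)
    then have Esc_diff: "(\<lambda>q. Esc q $ i) differentiable at p" for i
      by (simp add: Esc_v)
    have "Esc = (\<lambda>q. \<kappa> *s A q + grad v q)"
      by (rule ext) (rule Esc_v)
    then have "curl Esc p = curl (\<lambda>q. \<kappa> *s A q) p + curl (grad v) p"
      using Esc_parts by (simp only: curl_add)
    then have curl_Esc: "curl Esc p = \<kappa> *s curl A p"
      using curl_grad[OF domain(1) p v2] by (simp add: curl_cmult[OF diff(3)])
    have curl_E: "curl E p = curl Einc p + \<kappa> *s curl A p"
    proof -
      have "curl Esc p = curl (\<lambda>q. E q - Einc q) p"
        using Esc_eq by (rule curl_cong[OF domain(1) p])
      then show ?thesis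
        using curl_Esc by (simp add: curl_diff[OF diff(1,2)])
    qed
    have "curl B = (\<lambda>q. s *s (Esc q - J q))"
      by (rule ext) (rule curl_B)
    moreover have "(\<lambda>q. (Esc q - J q) $ i) differentiable at p" for i
      using Esc_diff[of i] diff(4)[of i] by simp
    ultimately have "curl (curl B) p = s *s curl (\<lambda>q. Esc q - J q) p"
      by (simp only: curl_cmult)
    then have curl_curl_B: "curl (curl B) p = s *s (\<kappa> *s curl A p - curl J p)"
      by (simp add: curl_diff[OF Esc_diff diff(4)] curl_Esc)

    have B_p: "B p = s *s curl A p"
      by (simp add: B_eq)
    \<comment> \<open>Dividing curl B by \<open>s\<close> leaves Esc - J; adding Einc completes Esc
      to E, and J = X E takes its share away.\<close>
    have F: "(Einc p + inverse s *s curl B p) $ i = (1 - X p) * E p $ i" for i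
      using s Esc_eq[OF p] by (simp add: curl_B J_def algebra_simps)
    have "volume_coeff num p =
        (\<Sum>i\<in>UNIV. (Einc p + inverse s *s curl B p) $ i * (curl (curl B) p - \<kappa> *s B p) $ i)"
      unfolding num form_laplacian_hodge_one_form[OF div_B B_diff] hodge_ext_d_one_form form_scale_hodge
        form_scale_one_form hodge_diff one_form_add one_form_diff
      by (rule volume_coeff_one_form_wedge_hodge)
    also have "\<dots> = (\<Sum>i\<in>UNIV. - (s * (1 - X p)) * (E p $ i * curl J p $ i))"
      unfolding F by (rule sum.cong) (simp_all add: curl_curl_B B_p algebra_simps)
    also have "\<dots> = - (s * (1 - X p)) * (X p * (\<Sum>i\<in>UNIV. E p $ i * curl E p $ i))"
      unfolding sum_distrib_left[symmetric] J_def
      using regularity(1) diff(1) by (subst dot_curl_scaled) (auto simp: numeral_2_eq_2 dest: differentiable_on_openD)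
    finally have num_eq: "volume_coeff num p = - X p * (s * (1 - X p) * (\<Sum>i\<in>UNIV. E p $ i * curl E p $ i))"
      by (simp add: mult_ac)
    have "volume_coeff den p =
        (\<Sum>i\<in>UNIV. (Einc p + inverse s *s curl B p) $ i * (s *s curl Einc p + \<kappa> *s B p) $ i)"
      unfolding den ext_d_one_form hodge_hodge form_scale_hodge
        form_scale_one_form hodge_add one_form_add
      by (rule volume_coeff_one_form_wedge_hodge)
    also have "\<dots> = (\<Sum>i\<in>UNIV. s * (1 - X p) * (E p $ i * curl E p $ i))"
      unfolding F by (rule sum.cong) (simp_all add: curl_E B_p algebra_simps)
    also have "\<dots> = s * (1 - X p) * (\<Sum>i\<in>UNIV. E p $ i * curl E p $ i)"
      by (rule sum_distrib_left[symmetric])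
    finally have "volume_coeff num p = - X p * volume_coeff den p"
      by (simp only: num_eq)
    with nz show ?thesis by simp
  qed
  show ?thesis
    unfolding Let_def s_def[symmetric] \<kappa>_def[symmetric]
    by (intro ballI impI main refl)
qed

end
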